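(* The semigroup $s\mathcal{R}(\mathfrak{S}_n)=\mathcal{R}(\mathfrak{S}_n)\setminus\mathfrak{S}_n$ is presented (as a semigroup) by generators $e_{i,j}$ and $z^r_{i,j}$ ($r\in[n-1]$, $i,j\in[n]$, $i<j$) subject to the relations: (a) $e_{i,j}^2=e_{i,j}$, $e_{i,j}e_{r,s}=e_{r,s}e_{i,j}$, and $e_{i,j}e_{i,k}=e_{i,j}e_{j,k}=e_{i,k}e_{j,k}$ for $i<j<k$; (b) $z^r_{i,j}z^t_{r(i),r(j)}z^r_{(t\circ r)(i),(t\circ r)(j)}=z^t_{i,j}z^r_{t(i),t(j)}z^t_{(r\circ t)(i),(r\circ t)(j)}$ for $|r-t|=1$; (c) $z^r_{i,j}z^t_{r(i),r(j)}=z^t_{i,j}z^r_{t(i),t(j)}$ for $|r-t|>1$; (d) $z^r_{i,j}z^r_{h,k}=e_{i,j}e_{r(h),r(k)}$, $e_{i,j}z^r_{i,j}=z^r_{i,j}$, and $z^r_{i,j}e_{h,k}=e_{r(h),r(k)}z^r_{i,j}$.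
   Context: $\mathfrak{C}_n$ is the partition monoid (set partitions of $[2n]$, top points $1..n$, bottom $n+1..2n$, concatenation product $*$). $I\preceq J$ means each block of $J$ is a union of blocks of $I$. $\mathfrak{S}_n\subseteq\mathfrak{C}_n$ consists of partitions with all blocks $\{i,n+j\}$; $s_r$ are the simple transpositions; $1=\{\{i,n+i\}\}$. $\mathcal{R}(\mathfrak{S}_n)$ is the monoid of pairs $(I,J)$ of set partitions of $[2n]$ with $I\in\mathfrak{S}_n$, $I\preceq J$, product $(I,J)(H,K)=(I*H,J*K)$; $\mathfrak{S}_n$ is identified with $\{(w,w)\}$. For $i<j$, $e_{i,j}=(1,J_{i,j})$ where $J_{i,j}$ merges the blocks $\{i,n+i\}$ and $\{j,n+j\}$ of $1$, and $z^r_{i,j}=e_{i,j}s_r$. Notation: $r(i)$ denotes the image of $i$ under $s_r$, and $(t\circ r)(i)$ denotes the image of $i$ under the permutation $s_ts_r$; indices written in decreasing order are read in increasing order ($e_{a,b}=e_{b,a}$, $z^r_{a,b}=z^r_{b,a}$). *)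

theory Defs
  imports "HOL-Library.Disjoint_Sets"
begin

text \<open>A set partition of [2n] = {1..2n} is a set of blocks (library notion partition_on).
  Top points are 1..n, bottom points are n+1..2n.\<close>

definition setpart :: "nat \<Rightarrow> nat set set \<Rightarrow> bool" where
  "setpart n P \<longleftrightarrow> partition_on {1..2*n} P"

text \<open>Concatenation product I * H: I is drawn above H, bottom row of I identified
  with top row of H.  Points are (level, index): level 0 = top of I, level 1 = middle,
  level 2 = bottom of H.\<close>

definition pos_up :: "nat \<Rightarrow> nat \<Rightarrow> nat \<times> nat" where
  "pos_up n x = (if x \<le> n then (0, x) else (1, x - n))"

definition pos_low :: "nat \<Rightarrow> nat \<Rightarrow> nat \<times> nat" where
  "pos_low n x = (if x \<le> n then (1, x) else (2, x - n))"

definition pos_out :: "nat \<Rightarrow> nat \<Rightarrow> nat \<times> nat" where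
  "pos_out n x = (if x \<le> n then (0, x) else (2, x - n))"

definition cstep :: "nat \<Rightarrow> nat set set \<Rightarrow> nat set set \<Rightarrow> nat \<times> nat \<Rightarrow> nat \<times> nat \<Rightarrow> bool" where
  "cstep n I H p q \<longleftrightarrow>
     (\<exists>B\<in>I. \<exists>x\<in>B. \<exists>y\<in>B. p = pos_up n x \<and> q = pos_up n y) \<or>
     (\<exists>B\<in>H. \<exists>x\<in>B. \<exists>y\<in>B. p = pos_low n x \<and> q = pos_low n y)"

definition pmul :: "nat \<Rightarrow> nat set set \<Rightarrow> nat set set \<Rightarrow> nat set set" where
  "pmul n I H = (\<lambda>x. {y \<in> {1..2*n}. (cstep n I H)\<^sup>*\<^sup>* (pos_out n x) (pos_out n y)}) ` {1..2*n}"

definition refines :: "nat set set \<Rightarrow> nat set set \<Rightarrow> bool" where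
  "refines I J \<longleftrightarrow> (\<forall>B\<in>J. \<exists>C\<subseteq>I. B = \<Union>C)"

definition Sym :: "nat \<Rightarrow> nat set set set" where
  "Sym n = {P. setpart n P \<and> (\<forall>B\<in>P. \<exists>i j. 1 \<le> i \<and> i \<le> n \<and> 1 \<le> j \<and> j \<le> n \<and> B = {i, n + j})}"

definition st :: "nat \<Rightarrow> nat \<Rightarrow> nat" where
  "st r i = (if i = r then r + 1 else if i = r + 1 then r else i)"

definition one_part :: "nat \<Rightarrow> nat set set" where
  "one_part n = {{i, n + i} | i. i \<in> {1..n}}"

definition s_part :: "nat \<Rightarrow> nat \<Rightarrow> nat set set" where
  "s_part n r = {{i, n + st r i} | i. i \<in> {1..n}}"

definition J_part :: "nat \<Rightarrow> nat \<Rightarrow> nat \<Rightarrow> nat set set" where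
  "J_part n i j = insert {i, j, n + i, n + j} {{k, n + k} | k. k \<in> {1..n} \<and> k \<noteq> i \<and> k \<noteq> j}"

definition RS :: "nat \<Rightarrow> (nat set set \<times> nat set set) set" where
  "RS n = {(I, J). I \<in> Sym n \<and> setpart n J \<and> refines I J}"

definition rmul :: "nat \<Rightarrow> nat set set \<times> nat set set \<Rightarrow> nat set set \<times> nat set set
                    \<Rightarrow> nat set set \<times> nat set set" where
  "rmul n a b = (pmul n (fst a) (fst b), pmul n (snd a) (snd b))"

text \<open>sR(S_n) = R(S_n) minus S_n, where S_n is identified with {(w,w)}.\<close>
definition sRS :: "nat \<Rightarrow> (nat set set \<times> nat set set) set" where
  "sRS n = RS n - {(w, w) | w. w \<in> Sym n}"

definition e_el :: "nat \<Rightarrow> nat \<Rightarrow> nat \<Rightarrow> nat set set \<times> nat set set" where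
  "e_el n i j = (one_part n, J_part n i j)"

definition z_el :: "nat \<Rightarrow> nat \<Rightarrow> nat \<Rightarrow> nat \<Rightarrow> nat set set \<times> nat set set" where
  "z_el n r i j = rmul n (e_el n i j) (s_part n r, s_part n r)"

datatype gen = E nat nat | Z nat nat nat

text \<open>Indices written in decreasing order are read in increasing order.\<close>
definition E' :: "nat \<Rightarrow> nat \<Rightarrow> gen" where
  "E' a b = E (min a b) (max a b)"

definition Z' :: "nat \<Rightarrow> nat \<Rightarrow> nat \<Rightarrow> gen" where
  "Z' r a b = Z r (min a b) (max a b)"

definition gens :: "nat \<Rightarrow> gen set" where
  "gens n = {E i j | i j. 1 \<le> i \<and> i < j \<and> j \<le> n}
          \<union> {Z r i j | r i j. 1 \<le> r \<and> r \<le> n - 1 \<and> 1 \<le> i \<and> i < j \<and> j \<le> n}"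

fun gen_val :: "nat \<Rightarrow> gen \<Rightarrow> nat set set \<times> nat set set" where
  "gen_val n (E i j) = e_el n i j"
| "gen_val n (Z r i j) = z_el n r i j"

text \<open>Evaluation of a nonempty word (the semigroup has no empty word).\<close>
fun evalw :: "nat \<Rightarrow> gen list \<Rightarrow> nat set set \<times> nat set set" where
  "evalw n [] = undefined"
| "evalw n (g # gs) = foldl (rmul n) (gen_val n g) (map (gen_val n) gs)"

abbreviation pair_ok :: "nat \<Rightarrow> nat \<Rightarrow> nat \<Rightarrow> bool" where
  "pair_ok n i j \<equiv> 1 \<le> i \<and> i < j \<and> j \<le> n"

abbreviation r_ok :: "nat \<Rightarrow> nat \<Rightarrow> bool" where
  "r_ok n r \<equiv> 1 \<le> r \<and> r \<le> n - 1"

inductive rels :: "nat \<Rightarrow> gen list \<Rightarrow> gen list \<Rightarrow> bool" for n where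
  a1: "pair_ok n i j \<Longrightarrow> rels n [E i j, E i j] [E i j]"
| a2: "pair_ok n i j \<Longrightarrow> pair_ok n r s \<Longrightarrow> rels n [E i j, E r s] [E r s, E i j]"
| a3: "1 \<le> i \<Longrightarrow> i < j \<Longrightarrow> j < k \<Longrightarrow> k \<le> n \<Longrightarrow> rels n [E i j, E i k] [E i j, E j k]"
| a4: "1 \<le> i \<Longrightarrow> i < j \<Longrightarrow> j < k \<Longrightarrow> k \<le> n \<Longrightarrow> rels n [E i j, E j k] [E i k, E j k]"
| b: "r_ok n r \<Longrightarrow> r_ok n t \<Longrightarrow> (r = t + 1 \<or> t = r + 1) \<Longrightarrow> pair_ok n i j \<Longrightarrow>
      rels n [Z r i j, Z' t (st r i) (st r j), Z' r (st t (st r i)) (st t (st r j))]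
             [Z t i j, Z' r (st t i) (st t j), Z' t (st r (st t i)) (st r (st t j))]"
| c: "r_ok n r \<Longrightarrow> r_ok n t \<Longrightarrow> (r + 1 < t \<or> t + 1 < r) \<Longrightarrow> pair_ok n i j \<Longrightarrow>
      rels n [Z r i j, Z' t (st r i) (st r j)] [Z t i j, Z' r (st t i) (st t j)]"
| d1: "r_ok n r \<Longrightarrow> pair_ok n i j \<Longrightarrow> pair_ok n h k \<Longrightarrow>
      rels n [Z r i j, Z r h k] [E i j, E' (st r h) (st r k)]"
| d2: "r_ok n r \<Longrightarrow> pair_ok n i j \<Longrightarrow> rels n [E i j, Z r i j] [Z r i j]"
| d3: "r_ok n r \<Longrightarrow> pair_ok n i j \<Longrightarrow> pair_ok n h k \<Longrightarrow>
      rels n [Z r i j, E h k] [E' (st r h) (st r k), Z r i j]"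

inductive wcong :: "nat \<Rightarrow> gen list \<Rightarrow> gen list \<Rightarrow> bool" for n where
  step: "rels n u v \<Longrightarrow> wcong n (x @ u @ y) (x @ v @ y)"
| refl: "wcong n w w"
| sym: "wcong n u v \<Longrightarrow> wcong n v u"
| trans: "wcong n u v \<Longrightarrow> wcong n v w \<Longrightarrow> wcong n u w"

end

theory Submission
  imports Defs "HOL-Combinatorics.Permutations"
begin

text \<open>An element \<open>(w, J)\<close> of \<open>R(S\<^sub>n)\<close> amounts to a permutation together with an equivalence
  relation on the top points, and multiplication is that of the semidirect product of the
  join-semilattice of equivalence relations with the symmetric group.

  For completeness, fix a pair \<open>(i, j)\<close> in the equivalence relation of a word. Relations (d)
  move all idempotents to the left and give \<open>e\<^sub>h\<^sub>k z\<^sup>r\<^sub>i\<^sub>j = e\<^sub>i\<^sub>j z\<^sup>r\<^sub>h\<^sub>k\<close>, so each letter \<open>z\<close> can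
  be made to carry the image of \<open>(i, j)\<close> under the letters before it. The word becomes a product of
  idempotents followed by a lift of a word in the simple transpositions. Relations (a) show that
  the first factor depends only on the equivalence relation. Relations (b), (c) and (d) lift the
  Coxeter relations, so the second factor depends only on the permutation.\<close>

section \<open>Word calculus\<close>

declare wcong.trans [trans]

lemma wcong_append_left: "wcong n u v \<Longrightarrow> wcong n (x @ u) (x @ v)"
proof (induction rule: wcong.induct)
  case (step u v y z)
  then show ?case using wcong.step[of n u v "x @ y" z] by simp
qed (auto intro: wcong.intros)

lemma wcong_append_right: "wcong n u v \<Longrightarrow> wcong n (u @ x) (v @ x)"
proof (induction rule: wcong.induct)
  case (step u v y z)
  then show ?case using wcong.step[of n u v y "z @ x"] by simp
qed (auto intro: wcong.intros)

lemma wcong_Cons: "wcong n u v \<Longrightarrow> wcong n (g # u) (g # v)"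
  using wcong_append_left[of n u v "[g]"] by simp

lemma wcong_pre1: "wcong n [a] v \<Longrightarrow> wcong n (a # w) (v @ w)"
  using wcong_append_right[of n "[a]" v w] by simp

lemma wcong_pre2: "wcong n [a, b] v \<Longrightarrow> wcong n (a # b # w) (v @ w)"
  using wcong_append_right[of n "[a, b]" v w] by simp

lemma wcong_rel: "rels n u v \<Longrightarrow> wcong n u v"
  using wcong.step[of n u v "[]" "[]"] by simp

section \<open>The defining relations for index pairs in either order\<close>

abbreviation idx :: "nat \<Rightarrow> nat \<Rightarrow> nat \<Rightarrow> bool" where
  "idx n i j \<equiv> i \<in> {1..n} \<and> j \<in> {1..n} \<and> i \<noteq> j"

lemma E'_commute: "E' i j = E' j i"
  by (simp add: E'_def min.commute max.commute)

lemma Z'_commute: "Z' r i j = Z' r j i"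
  by (simp add: Z'_def min.commute max.commute)

lemma E'_less: "i < j \<Longrightarrow> E' i j = E i j" by (simp add: E'_def)
lemma Z'_less: "i < j \<Longrightarrow> Z' r i j = Z r i j" by (simp add: Z'_def)

lemma st_st [simp]: "st r (st r i) = i" by (simp add: st_def)

lemma st_eq_iff [simp]: "st r i = st r j \<longleftrightarrow> i = j" by (metis st_st)

lemma st_in_range: "r_ok n r \<Longrightarrow> i \<in> {1..n} \<Longrightarrow> st r i \<in> {1..n}" by (auto simp: st_def)

lemma idx_st: "r_ok n r \<Longrightarrow> idx n i j \<Longrightarrow> idx n (st r i) (st r j)"
  using st_in_range[of r n i] st_in_range[of r n j] by simp

lemma E_idem: assumes "idx n i j" shows "wcong n [E' i j, E' i j] [E' i j]"
  using assms unfolding E'_def by (intro wcong_rel rels.a1) auto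

lemma E_comm: assumes "idx n i j" "idx n h k" shows "wcong n [E' i j, E' h k] [E' h k, E' i j]"
  using assms unfolding E'_def by (intro wcong_rel rels.a2) auto

text \<open>The three-index relations equate three products and commutation reverses each of them,
  so all six products of two distinct idempotents on a triple are congruent. A fixed one serves as
  representative.\<close>

lemma E_triangle_sorted:
  assumes "1 \<le> a" "a < b" "b < c" "c \<le> n"
    and "x \<in> {E' a b, E' a c, E' b c}" "y \<in> {E' a b, E' a c, E' b c}" "x \<noteq> y"
  shows "wcong n [x, y] [E' a b, E' a c]"
proof -
  let ?x = "E' a b" let ?y = "E' a c" let ?z = "E' b c"
  have 1: "wcong n [?x, ?z] [?x, ?y]" and 2: "wcong n [?y, ?z] [?x, ?z]"
    using wcong_rel[OF rels.a3[of a b c n]] wcong_rel[OF rels.a4[of a b c n]] assms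
    by (auto simp: E'_less intro: wcong.sym)
  note c = E_comm[of a n b a c] E_comm[of a n b b c] E_comm[of a n c b c]
  show ?thesis
    using assms 1 2 c by (auto intro: wcong.intros(2-4))
qed

text \<open>Freed from the order of the indices, the triangle relation becomes the transitivity step
  used to absorb idempotents along a path.\<close>

lemma E_triangle:
  assumes "idx n i j" "idx n j k" "i \<noteq> k"
  shows "wcong n [E' i j, E' i k] [E' i j, E' j k]"
proof -
  have *: "wcong n [E' i j, E' i k] [E' i j, E' j k]"
    if "1 \<le> a" "a < b" "b < c" "c \<le> n" "{i,j,k} = {a,b,c}" for a b c
  proof -
    have i: "E' p q \<in> {E' a b, E' a c, E' b c}" if "p \<in> {a,b,c}" "q \<in> {a,b,c}" "p \<noteq> q" for p q
      using that by (auto simp: E'_commute)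
    have d: "i \<in> {a,b,c}" "j \<in> {a,b,c}" "k \<in> {a,b,c}" using that by auto
    have ne: "E' i j \<noteq> E' i k" "E' i j \<noteq> E' j k"
      using assms by (auto simp: E'_def min_def max_def split: if_splits)
    show ?thesis
      using E_triangle_sorted[OF that(1-4) i i ne(1)] E_triangle_sorted[OF that(1-4) i i ne(2)] d assms
      by (metis wcong.sym wcong.trans)
  qed
  consider "i < j" "j < k" | "i < k" "k < j" | "j < i" "i < k" | "j < k" "k < i" | "k < i" "i < j" | "k < j" "j < i"
    using assms by linarith
  then show ?thesis
    by cases
      ((rule *[of i j k], use assms in auto)[1], (rule *[of i k j], use assms in auto)[1],
        (rule *[of j i k], use assms in auto)[1], (rule *[of j k i], use assms in auto)[1],
        (rule *[of k i j], use assms in auto)[1], (rule *[of k j i], use assms in auto)[1])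
qed

lemma Z_braid:
  assumes "r_ok n r" "r_ok n t" "r = t + 1 \<or> t = r + 1" "idx n i j"
  shows "wcong n [Z' r i j, Z' t (st r i) (st r j), Z' r (st t (st r i)) (st t (st r j))]
     [Z' t i j, Z' r (st t i) (st t j), Z' t (st r (st t i)) (st r (st t j))]"
proof -
  have *: "wcong n [Z' r a b, Z' t (st r a) (st r b), Z' r (st t (st r a)) (st t (st r b))]
     [Z' t a b, Z' r (st t a) (st t b), Z' t (st r (st t a)) (st r (st t b))]"
    if "idx n a b" "a < b" for a b
    unfolding Z'_less[OF that(2)] by (intro wcong_rel rels.b assms) (use that in auto)
  show ?thesis
  proof (cases "i < j")
    case False
    then show ?thesis using *[of j i] assms(4)
      by (simp only: Z'_commute[of _ i] Z'_commute[of _ "st r i"] Z'_commute[of _ "st t i"]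
          Z'_commute[of _ "st t (st r i)"] Z'_commute[of _ "st r (st t i)"]) auto
  qed (rule *[OF assms(4)])
qed

lemma Z_far:
  assumes "r_ok n r" "r_ok n t" "r + 1 < t \<or> t + 1 < r" "idx n i j"
  shows "wcong n [Z' r i j, Z' t (st r i) (st r j)] [Z' t i j, Z' r (st t i) (st t j)]"
proof -
  have *: "wcong n [Z' r a b, Z' t (st r a) (st r b)] [Z' t a b, Z' r (st t a) (st t b)]"
    if "idx n a b" "a < b" for a b
    unfolding Z'_less[OF that(2)] by (intro wcong_rel rels.c assms) (use that in auto)
  show ?thesis
  proof (cases "i < j")
    case False
    then show ?thesis using *[of j i] assms(4)
      by (simp only: Z'_commute[of _ i] Z'_commute[of _ "st r i"] Z'_commute[of _ "st t i"]) auto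
  qed (rule *[OF assms(4)])
qed

text \<open>The relations (d) are stated for increasing pairs, so sorting the indices first leaves
  \<open>min\<close> and \<open>max\<close> under \<open>st r\<close>; symmetry of \<open>E'\<close>
  removes them.\<close>

lemma E'_st_min_max: "E' (st r (min h k)) (st r (max h k)) = E' (st r h) (st r k)"
  by (cases "h \<le> k") (auto simp: min_def max_def E'_commute)

lemma Z_mult_Z:
  assumes "r_ok n r" "idx n i j" "idx n h k"
  shows "wcong n [Z' r i j, Z' r h k] [E' i j, E' (st r h) (st r k)]"
  unfolding E'_st_min_max[of r h k, symmetric] unfolding E'_def[of i j] Z'_def
  by (intro wcong_rel rels.d1) (use assms in auto)

lemma E_absorb_Z:
  assumes "r_ok n r" "idx n i j"
  shows "wcong n [E' i j, Z' r i j] [Z' r i j]"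
  unfolding E'_def Z'_def by (intro wcong_rel rels.d2) (use assms in auto)

lemma Z_mult_E:
  assumes "r_ok n r" "idx n i j" "idx n h k"
  shows "wcong n [Z' r i j, E' h k] [E' (st r h) (st r k), Z' r i j]"
  unfolding E'_st_min_max[of r h k, symmetric] unfolding E'_def[of h k] Z'_def
  by (intro wcong_rel rels.d3) (use assms in auto)

text \<open>The trick is to push \<open>e\<^sub>h\<^sub>k\<close> to the right of \<open>z\<close> and write it there as a product of two
  letters \<open>z\<close>.\<close>

lemma E_Z_exchange:
  assumes r: "r_ok n r" and ij: "idx n i j" and hk: "idx n h k"
  shows "wcong n [E' h k, Z' r i j] [E' i j, Z' r h k]"
proof -
  let ?h = "st r h" and ?k = "st r k"
  have hk': "idx n ?h ?k" using idx_st[OF r hk] .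
  have "wcong n [E' h k, Z' r i j] [Z' r i j, E' ?h ?k]"
    using Z_mult_E[OF r ij hk'] by (auto intro: wcong.sym)
  also have "wcong n \<dots> [Z' r i j, E' ?h ?k, E' ?h ?k]"
    using wcong_Cons[OF wcong.sym[OF E_idem[OF hk']], of "Z' r i j"] by simp
  also have "wcong n \<dots> [Z' r i j, Z' r ?h ?k, Z' r h k]"
    using wcong_Cons[OF wcong.sym[OF Z_mult_Z[OF r hk' hk]]] by simp
  also have "wcong n \<dots> [E' i j, E' h k, Z' r h k]"
    using wcong_pre2[OF Z_mult_Z[OF r ij hk']] by simp
  also have "wcong n \<dots> [E' i j, Z' r h k]"
    using wcong_Cons[OF E_absorb_Z[OF r hk]] by simp
  finally show ?thesis .
qed

section \<open>Moving idempotents to the left: the normal form of a word\<close>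

abbreviation Ew :: "(nat \<times> nat) list \<Rightarrow> gen list" where
  "Ew L \<equiv> map (\<lambda>(i, j). E' i j) L"

text \<open>The lift of a word in simple transpositions: each letter carries the image of the
  starting pair under the letters before it.\<close>

fun Zseq :: "nat \<Rightarrow> nat \<Rightarrow> nat list \<Rightarrow> gen list" where
  "Zseq i j [] = []"
| "Zseq i j (r # rs) = Z' r i j # Zseq (st r i) (st r j) rs"

fun perm_word :: "gen list \<Rightarrow> nat list" where
  "perm_word [] = []"
| "perm_word (E i j # w) = perm_word w"
| "perm_word (Z r i j # w) = r # perm_word w"

text \<open>The pairs \<open>(i, j)\<close> of the idempotents \<open>e\<^sub>i\<^sub>j\<close> obtained by moving all
  idempotents of a word to the left.\<close>

fun pair_list :: "gen list \<Rightarrow> (nat \<times> nat) list" where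
  "pair_list [] = []"
| "pair_list (E i j # w) = (i, j) # pair_list w"
| "pair_list (Z r i j # w) = (i, j) # map (map_prod (st r) (st r)) (pair_list w)"

abbreviation idxs :: "nat \<Rightarrow> (nat \<times> nat) list \<Rightarrow> bool" where
  "idxs n L \<equiv> (\<forall>(i, j) \<in> set L. idx n i j)"

lemma idxs_map_st: "r_ok n r \<Longrightarrow> idxs n L \<Longrightarrow> idxs n (map (map_prod (st r) (st r)) L)"
  using idx_st by (fastforce)

lemma gensE:
  assumes "g \<in> gens n"
  obtains i j where "g = E i j" "g = E' i j" "idx n i j" "i < j"
  | r i j where "g = Z r i j" "g = Z' r i j" "r_ok n r" "idx n i j" "i < j"
  using assms unfolding gens_def by (auto simp: E'_less Z'_less)

lemma pair_list_idxs: "set w \<subseteq> gens n \<Longrightarrow> idxs n (pair_list w)"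
proof (induction w)
  case (Cons g w)
  then have IH: "idxs n (pair_list w)" and g: "g \<in> gens n" by auto
  from g show ?case
  proof (cases rule: gensE)
    case 1 then show ?thesis using IH by auto
  next
    case (2 r i j)
    then show ?thesis using idxs_map_st[OF 2(3) IH] by (simp only: pair_list.simps) auto
  qed
qed simp

lemma perm_word_range: "set w \<subseteq> gens n \<Longrightarrow> set (perm_word w) \<subseteq> {1..n - 1}"
proof (induction w)
  case (Cons g w)
  then have IH: "set (perm_word w) \<subseteq> {1..n - 1}" and g: "g \<in> gens n" by auto
  from g show ?case by (cases rule: gensE) (use IH in auto)
qed simp

lemma E_move_Ew:
  assumes "idx n i j" "idxs n L"
  shows "wcong n (E' i j # Ew L) (Ew L @ [E' i j])"
  using assms(2)
proof (induction L)
  case (Cons p L)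
  obtain h k where p: "p = (h, k)" by force
  have "wcong n (E' i j # E' h k # Ew L) (E' h k # E' i j # Ew L)"
    using wcong_pre2[OF E_comm[OF assms(1)], of h k "Ew L"] Cons.prems p by simp
  also have "wcong n \<dots> (E' h k # Ew L @ [E' i j])"
    using Cons by (intro wcong_Cons) auto
  finally show ?case using p by simp
qed (simp add: wcong.refl)

lemma Ew_comm:
  assumes "idxs n L" "idxs n M"
  shows "wcong n (Ew L @ Ew M) (Ew M @ Ew L)"
  using assms(1)
proof (induction L)
  case (Cons p L)
  obtain h k where p: "p = (h, k)" by force
  have "wcong n (E' h k # Ew L @ Ew M) (E' h k # Ew M @ Ew L)"
    using Cons by (intro wcong_Cons) auto
  also have "wcong n \<dots> (Ew M @ E' h k # Ew L)"
    using wcong_append_right[OF E_move_Ew[OF _ assms(2)], of h k "Ew L"] Cons.prems p by simp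
  finally show ?case using p by simp
qed (simp add: wcong.refl)

lemma Z_move_Ew:
  assumes "r_ok n r" "idx n i j" "idxs n L"
  shows "wcong n (Z' r i j # Ew L) (Ew (map (map_prod (st r) (st r)) L) @ [Z' r i j])"
  using assms(3)
proof (induction L)
  case (Cons p L)
  obtain h k where p: "p = (h, k)" by force
  have "wcong n (Z' r i j # E' h k # Ew L) (E' (st r h) (st r k) # Z' r i j # Ew L)"
    using wcong_pre2[OF Z_mult_E[OF assms(1,2)], of h k "Ew L"] Cons.prems p by simp
  also have "wcong n \<dots> (E' (st r h) (st r k) # Ew (map (map_prod (st r) (st r)) L) @ [Z' r i j])"
    using Cons by (intro wcong_Cons) auto
  finally show ?case using p by simp
qed (simp add: wcong.refl)

text \<open>The idempotent absorbed on the left of a letter \<open>Z'\<close> can be pushed to its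
  right, where it carries the image of the pair. This supplies the leading idempotent for the rest
  of a word.\<close>

lemma Z_E_tail:
  assumes "r_ok n r" "idx n i j"
  shows "wcong n [Z' r i j] [Z' r i j, E' (st r i) (st r j)]"
proof -
  have "wcong n [Z' r i j] [E' i j, Z' r i j]"
    using E_absorb_Z[OF assms] by (rule wcong.sym)
  also have "wcong n \<dots> [Z' r i j, E' (st r i) (st r j)]"
    using Z_mult_E[OF assms idx_st[OF assms]] by (auto intro: wcong.sym)
  finally show ?thesis .
qed

text \<open>The leading idempotent lets the first letter \<open>Z' r a b\<close> be relabelled by
  \<open>(i, j)\<close>, at the cost of an idempotent \<open>E' a b\<close>. It then reappears
  behind that letter with its pair moved by \<open>st r\<close>, so the induction has to run over
  arbitrary \<open>i\<close> and \<open>j\<close>.\<close>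

lemma normal_form:
  assumes "set w \<subseteq> gens n" "idx n i j"
  shows "wcong n (E' i j # w) (E' i j # Ew (pair_list w) @ Zseq i j (perm_word w))"
  using assms
proof (induction w arbitrary: i j)
  case (Cons g w)
  then have g: "g \<in> gens n" and w: "set w \<subseteq> gens n" by auto
  have ij: "idx n i j" using Cons.prems by blast
  from g show ?case
  proof (cases rule: gensE)
    case (1 a b)
    have swap: "wcong n (E' i j # E' a b # v) (E' a b # E' i j # v)" for v
      using wcong_pre2[OF E_comm[OF ij 1(3)]] by simp
    have "wcong n (E' i j # E' a b # w) (E' a b # E' i j # w)"
      by (rule swap)
    also have "wcong n \<dots> (E' a b # E' i j # Ew (pair_list w) @ Zseq i j (perm_word w))"
      by (intro wcong_Cons Cons.IH w ij)
    also have "wcong n \<dots> (E' i j # E' a b # Ew (pair_list w) @ Zseq i j (perm_word w))"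
      by (rule wcong.sym[OF swap])
    finally show ?thesis using 1 by simp
  next
    case (2 r a b)
    let ?i = "st r i" and ?j = "st r j"
    have ij': "idx n ?i ?j" by (rule idx_st[OF 2(3) ij])
    have swap: "wcong n (E' i j # E' a b # v) (E' a b # E' i j # v)" for v
      using wcong_pre2[OF E_comm[OF ij 2(4)]] by simp
    have "wcong n (E' i j # Z' r a b # w) (E' i j # E' a b # Z' r a b # w)"
      using wcong_Cons[OF wcong_pre1[OF wcong.sym[OF E_absorb_Z[OF 2(3,4)]]]] by simp
    also have "wcong n \<dots> (E' a b # E' i j # Z' r a b # w)" by (rule swap)
    also have "wcong n \<dots> (E' a b # E' a b # Z' r i j # w)"
      using wcong_Cons[OF wcong_pre2[OF E_Z_exchange[OF 2(3,4) ij]]] by simp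
    also have "wcong n \<dots> (E' a b # Z' r i j # w)"
      using wcong_pre2[OF E_idem[OF 2(4)]] by simp
    also have "wcong n \<dots> (E' a b # Z' r i j # E' ?i ?j # w)"
      using wcong_Cons[OF wcong_pre1[OF Z_E_tail[OF 2(3) ij]]] by simp
    also have "wcong n \<dots> (E' a b # Z' r i j # E' ?i ?j # Ew (pair_list w) @ Zseq ?i ?j (perm_word w))"
      by (intro wcong_Cons Cons.IH w ij')
    also have "wcong n \<dots> (E' a b # E' i j # Ew (map (map_prod (st r) (st r)) (pair_list w))
        @ Z' r i j # Zseq ?i ?j (perm_word w))"
    proof -
      \<comment> \<open>The auxiliary idempotent \<open>E' ?i ?j\<close> moves back together with
        those of the tail and turns into \<open>E' i j\<close> again, because \<open>st r\<close> is
        an involution.\<close>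
      have L: "idxs n ((?i, ?j) # pair_list w)" using ij' pair_list_idxs[OF w] by auto
      show ?thesis
        using wcong_Cons[OF wcong_append_right[OF Z_move_Ew[OF 2(3) ij L]]] by simp
    qed
    also have "wcong n \<dots> (E' i j # E' a b # Ew (map (map_prod (st r) (st r)) (pair_list w))
        @ Z' r i j # Zseq ?i ?j (perm_word w))"
      by (rule wcong.sym[OF swap])
    finally show ?thesis using 2 by simp
  qed
qed (simp add: wcong.refl)

section \<open>Products of idempotents and the equivalence relations they generate\<close>

definition Eqv :: "('a \<times> 'a) set \<Rightarrow> ('a \<times> 'a) set" where
  "Eqv S = (S \<union> S\<inverse>)\<^sup>*"

text \<open>Commutation brings the letter next to its own copy in the list, and idempotency merges
  the two.\<close>

lemma E_absorb_mem:
  assumes "idxs n L" "(i, j) \<in> set L \<or> (j, i) \<in> set L"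
  shows "wcong n (E' i j # Ew L) (Ew L)"
proof -
  obtain x y where xy: "(x, y) \<in> set L" "E' i j = E' x y" using assms(2) E'_commute by blast
  then have v: "idx n x y" using assms(1) by auto
  obtain A B where L: "L = A @ (x, y) # B" using xy(1) by (meson split_list)
  have "wcong n (E' x y # Ew A @ E' x y # Ew B) (Ew A @ E' x y # E' x y # Ew B)"
    using wcong_append_right[OF E_move_Ew[OF v], of A "E' x y # Ew B"] assms(1) L by simp
  also have "wcong n \<dots> (Ew A @ E' x y # Ew B)"
    using wcong_append_left[OF wcong_pre2[OF E_idem[OF v]]] by simp
  finally show ?thesis using L xy(2) by simp
qed

text \<open>Induction along a path of pairs from \<open>i\<close> to \<open>j\<close>: once
  \<open>E' i c\<close> and \<open>E' c d\<close> are absorbed, the triangle relation replaces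
  \<open>E' i d\<close> beside \<open>E' i c\<close> by \<open>E' c d\<close>.\<close>

lemma E_absorb_Eqv:
  assumes L: "idxs n L" and ij: "(i, j) \<in> Eqv (set L)" "i \<noteq> j"
  shows "idx n i j \<and> wcong n (E' i j # Ew L) (Ew L)"
proof -
  \<comment> \<open>The implication makes the claim vacuous whenever the path is at its starting
    point, where no idempotent exists.\<close>
  have "i \<noteq> j \<longrightarrow> idx n i j \<and> wcong n (E' i j # Ew L) (Ew L)"
    using ij(1) unfolding Eqv_def
  proof (induction rule: rtrancl_induct)
    case (step c d)
    have cdL: "(c, d) \<in> set L \<or> (d, c) \<in> set L" using step.hyps by auto
    then have cd: "idx n c d" using L by auto
    have cdw: "wcong n (E' c d # Ew L) (Ew L)" by (rule E_absorb_mem[OF L cdL])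
    show ?case
    proof (cases "i = c")
      case True
      then show ?thesis using cd cdw by auto
    next
      case False
      show ?thesis
      proof
        assume "i \<noteq> d"
        have ic: "idx n i c" and icw: "wcong n (E' i c # Ew L) (Ew L)" using step.IH False by auto
        have id: "idx n i d" using ic cd \<open>i \<noteq> d\<close> by auto
        have "wcong n (E' i d # Ew L) (E' i d # E' i c # Ew L)"
          by (intro wcong_Cons wcong.sym[OF icw])
        also have "wcong n \<dots> (E' i c # E' i d # Ew L)"
          using wcong_pre2[OF E_comm[OF id ic]] by simp
        also have "wcong n \<dots> (E' i c # E' c d # Ew L)"
          using wcong_pre2[OF E_triangle[OF ic cd \<open>i \<noteq> d\<close>]] by simp
        also have "wcong n \<dots> (E' i c # Ew L)" by (intro wcong_Cons cdw)
        also have "wcong n \<dots> (Ew L)" by (rule icw)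
        finally show "idx n i d \<and> wcong n (E' i d # Ew L) (Ew L)" using id by blast
      qed
    qed
  qed simp
  then show ?thesis using ij(2) by blast
qed

lemma Ew_absorb:
  assumes L: "idxs n L" and M: "idxs n M" "set M \<subseteq> Eqv (set L)"
  shows "wcong n (Ew M @ Ew L) (Ew L)"
  using M
proof (induction M)
  case (Cons p M)
  obtain h k where p: "p = (h, k)" by force
  have "wcong n (E' h k # Ew M @ Ew L) (E' h k # Ew L)"
    using Cons by (intro wcong_Cons) auto
  also have "wcong n \<dots> (Ew L)" using E_absorb_Eqv[OF L] Cons.prems p by auto
  finally show ?case using p by simp
qed (simp add: wcong.refl)

lemma subset_Eqv: "S \<subseteq> Eqv S" by (auto simp: Eqv_def)

text \<open>Each of the two words absorbs the other, and they commute.\<close>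

lemma Ew_eq:
  assumes "idxs n L" "idxs n M" "Eqv (set L) = Eqv (set M)"
  shows "wcong n (Ew L) (Ew M)"
proof -
  have "wcong n (Ew L) (Ew M @ Ew L)"
    using Ew_absorb[OF assms(1,2)] subset_Eqv[of "set M"] assms(3) by (auto intro: wcong.sym)
  also have "wcong n \<dots> (Ew L @ Ew M)" by (rule Ew_comm[OF assms(2,1)])
  also have "wcong n \<dots> (Ew M)"
    using Ew_absorb[OF assms(2,1)] subset_Eqv[of "set L"] assms(3) by auto
  finally show ?thesis .
qed

text \<open>The first letter supplies an idempotent \<open>E' h k\<close>, which gives a normal form
  along \<open>(h, k)\<close>. To change the pair, \<open>E' i j\<close> is inserted into that form,
  moved to the front, and the form is folded back into \<open>w\<close> before being expanded along
  \<open>(i, j)\<close>. Hence the pair may be chosen from the equivalence relation alone.\<close>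

lemma normal_form_Eqv:
  assumes w: "set w \<subseteq> gens n" "w \<noteq> []" and ij: "(i, j) \<in> Eqv (set (pair_list w))" "i \<noteq> j"
  shows "wcong n w (E' i j # Ew (pair_list w) @ Zseq i j (perm_word w))"
proof -
  obtain g v where gv: "w = g # v" using w(2) by (cases w) auto
  then have "g \<in> gens n" using w(1) by auto
  then obtain h k where hk: "idx n h k" "wcong n [g] [E' h k, g]" "(h, k) \<in> set (pair_list w)"
  proof (cases rule: gensE)
    case (1 a b)
    show ?thesis by (rule that[OF 1(3)]) (use 1 gv wcong.sym[OF E_idem[OF 1(3)]] in auto)
  next
    case (2 r a b)
    show ?thesis by (rule that[OF 2(4)]) (use 2 gv wcong.sym[OF E_absorb_Z[OF 2(3,4)]] in auto)
  qed
  have L: "idxs n (pair_list w)" by (rule pair_list_idxs[OF w(1)])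
  have abs: "idx n i j" "wcong n (E' i j # Ew (pair_list w)) (Ew (pair_list w))"
    using E_absorb_Eqv[OF L ij] by blast+
  have E_hk: "wcong n w (E' h k # w)"
    using wcong_pre1[OF hk(2), of v] gv by simp
  have nf: "wcong n (E' h k # w) (E' h k # Ew (pair_list w) @ Zseq h k (perm_word w))"
    by (rule normal_form[OF w(1) hk(1)])
  have "wcong n w (E' h k # Ew (pair_list w) @ Zseq h k (perm_word w))"
    using wcong.trans[OF E_hk nf] .
  \<comment> \<open>The idempotent part absorbs \<open>E' i j\<close>, so inserting it changes
    nothing.\<close>
  also have "wcong n \<dots> (E' h k # E' i j # Ew (pair_list w) @ Zseq h k (perm_word w))"
    using wcong_Cons[OF wcong_append_right[OF wcong.sym[OF abs(2)]]] by simp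
  also have "wcong n \<dots> (E' i j # E' h k # Ew (pair_list w) @ Zseq h k (perm_word w))"
    using wcong_pre2[OF E_comm[OF hk(1) abs(1)]] by simp
  also have "wcong n \<dots> (E' i j # w)"
    by (intro wcong_Cons wcong.sym[OF wcong.trans[OF E_hk nf]])
  also have "wcong n \<dots> (E' i j # Ew (pair_list w) @ Zseq i j (perm_word w))"
    by (rule normal_form[OF w(1) abs(1)])
  finally show ?thesis .
qed

section \<open>The Coxeter presentation of the symmetric group\<close>

text \<open>The congruence of the Coxeter presentation of type \<open>A_m\<close>, whose group is
  the symmetric group on \<open>{1..Suc m}\<close>.\<close>

inductive cox :: "nat \<Rightarrow> nat list \<Rightarrow> nat list \<Rightarrow> bool" for m where
  braid: "1 \<le> r \<Longrightarrow> r + 1 \<le> m \<Longrightarrow> cox m (x @ [r, r + 1, r] @ y) (x @ [r + 1, r, r + 1] @ y)"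
| far: "1 \<le> r \<Longrightarrow> r + 1 < t \<Longrightarrow> t \<le> m \<Longrightarrow> cox m (x @ [r, t] @ y) (x @ [t, r] @ y)"
| square: "1 \<le> r \<Longrightarrow> r \<le> m \<Longrightarrow> cox m (x @ [r, r] @ y) (x @ y)"
| refl: "cox m w w"
| sym: "cox m u v \<Longrightarrow> cox m v u"
| trans: "cox m u v \<Longrightarrow> cox m v w \<Longrightarrow> cox m u w"

declare cox.trans [trans]

lemma cox_range: "cox m u v \<Longrightarrow> set u \<subseteq> {1..m} \<longleftrightarrow> set v \<subseteq> {1..m}"
  by (induction rule: cox.induct) auto

lemma cox_mono: "cox m u v \<Longrightarrow> m \<le> k \<Longrightarrow> cox k u v"
proof (induction rule: cox.induct)
  case (braid r x y)
  then show ?case by (intro cox.braid) auto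
next
  case (far r t x y)
  then show ?case by (intro cox.far) auto
next
  case (square r x y)
  then show ?case by (intro cox.square) auto
qed (blast intro: cox.intros)+

lemma cox_context: "cox m u v \<Longrightarrow> cox m (p @ u @ q) (p @ v @ q)"
proof (induction rule: cox.induct)
  case (braid r x y)
  then show ?case using cox.braid[of r m "p @ x" "y @ q"] by simp
next
  case (far r t x y)
  then show ?case using cox.far[of r t m "p @ x" "y @ q"] by simp
next
  case (square r x y)
  then show ?case using cox.square[of r m "p @ x" "y @ q"] by simp
qed (auto intro: cox.intros)

lemma cox_append: "cox m u u' \<Longrightarrow> cox m v v' \<Longrightarrow> cox m (u @ v) (u' @ v')"
  using cox_context[of m u u' "[]" v] cox_context[of m v v' u' "[]"] by (auto intro: cox.trans)

text \<open>The first letter acts first, in agreement with diagrams whose left factor is drawn on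
  top.\<close>

fun perm_of :: "nat list \<Rightarrow> nat \<Rightarrow> nat" where
  "perm_of [] = id"
| "perm_of (r # rs) = perm_of rs \<circ> st r"

lemma perm_of_append: "perm_of (u @ v) = perm_of v \<circ> perm_of u"
  by (induction u) auto

lemma st_permutes: "1 \<le> r \<Longrightarrow> r \<le> m \<Longrightarrow> st r permutes {1..Suc m}"
  by (rule bij_imp_permutes) (auto simp: st_def bij_betw_def inj_on_def image_iff)

lemma perm_of_permutes: "set w \<subseteq> {1..m} \<Longrightarrow> perm_of w permutes {1..Suc m}"
proof (induction w)
  case Nil
  show ?case by (simp add: permutes_id del: id_apply)
next
  case (Cons r w)
  then show ?case using permutes_compose[OF st_permutes[of r m], of "perm_of w"] by (simp del: comp_apply)
qed

lemma cox_perm_of: "cox m u v \<Longrightarrow> perm_of u = perm_of v"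
proof (induction rule: cox.induct)
  case (braid r x y)
  have "st r \<circ> st (r + 1) \<circ> st r = st (r + 1) \<circ> st r \<circ> st (r + 1)"
    by (auto simp: st_def fun_eq_iff)
  then show ?case by (simp add: perm_of_append fun_eq_iff)
next
  case (far r t x y)
  then have "st r \<circ> st t = st t \<circ> st r" by (auto simp: st_def fun_eq_iff)
  then show ?case by (simp add: perm_of_append fun_eq_iff)
next
  case (square r x y)
  show ?case by (simp add: perm_of_append fun_eq_iff)
qed auto

text \<open>The word \<open>m, m - 1, ..., k\<close>, empty for \<open>k = Suc m\<close>. For
  \<open>1 \<le> k \<le> Suc m\<close> these words represent the cosets of the symmetric group on
  \<open>{1..m}\<close> in that on \<open>{1..Suc m}\<close>.\<close>

definition desc :: "nat \<Rightarrow> nat \<Rightarrow> nat list" where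
  "desc m k = rev [k..<Suc m]"

lemma set_desc: "set (desc m k) = {k..m}" by (auto simp: desc_def)

lemma desc_snoc: "k \<le> m \<Longrightarrow> desc m k = desc m (Suc k) @ [k]"
  by (simp add: desc_def upt_rec[of k "Suc m"] del: upt_Suc)

lemma desc_split: "k \<le> r \<Longrightarrow> r \<le> m \<Longrightarrow> desc m k = desc m (Suc r) @ desc r k"
  using upt_add_eq_append[of k "Suc r" "m - r"] by (simp add: desc_def del: upt_Suc)

lemma desc_empty: "desc m (Suc m) = []" by (simp add: desc_def)

text \<open>Each letter moves the point one place down, from \<open>Suc m\<close> to
  \<open>k\<close>. Thus \<open>k\<close> can be recovered from the permutation.\<close>

lemma perm_of_desc: "1 \<le> k \<Longrightarrow> k \<le> Suc m \<Longrightarrow> perm_of (desc m k) (Suc m) = k"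
proof (induction "Suc m - k" arbitrary: k)
  case 0
  then have "k = Suc m" by simp
  then show ?case by (simp add: desc_empty)
next
  case (Suc d)
  then have "perm_of (desc m (Suc k)) (Suc m) = Suc k" by auto
  moreover have "k \<le> m" using Suc by simp
  ultimately show ?case by (simp add: desc_snoc perm_of_append st_def)
qed

lemma cox_far_list:
  assumes "r \<in> {1..m}" "\<forall>t \<in> set v. t \<in> {1..m} \<and> (r + 1 < t \<or> t + 1 < r)"
  shows "cox m (v @ [r]) (r # v)"
  using assms(2)
proof (induction v)
  case (Cons t v)
  have "cox m (t # v @ [r]) (t # r # v)"
    using cox_append[OF cox.refl[of m "[t]"] Cons.IH] Cons.prems by simp
  also have "cox m \<dots> (r # t # v)"
    using cox.far[of r t m "[]" v] cox.far[of t r m "[]" v] Cons.prems assms(1)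
    by (auto intro: cox.sym)
  finally show ?case by simp
qed (simp add: cox.refl)

text \<open>The coset representatives are closed under right multiplication by a letter, up to
  letters below \<open>m\<close> on the left. A letter \<open>r < k - 1\<close> commutes past the
  whole word, \<open>r = k - 1\<close> extends it, \<open>r = k\<close> cancels its last letter, and
  \<open>r > k\<close> passes through it and comes out as \<open>r - 1\<close>.\<close>

lemma desc_times_letter:
  assumes m: "1 \<le> m" and k: "1 \<le> k" "k \<le> Suc m" and r: "1 \<le> r" "r \<le> m"
  shows "\<exists>v k'. set v \<subseteq> {1..m - 1} \<and> 1 \<le> k' \<and> k' \<le> Suc m \<and> cox m (desc m k @ [r]) (v @ desc m k')"
proof -
  consider "Suc r < k" | "Suc r = k" | "r = k" | "k < r" by linarith
  then show ?thesis
  proof cases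
    case 1
    have "cox m (desc m k @ [r]) ([r] @ desc m k)"
      using cox_far_list[of r m "desc m k"] 1 k r by (auto simp: set_desc)
    then show ?thesis using 1 k r by (intro exI[of _ "[r]"] exI[of _ k]) auto
  next
    case 2
    then have "desc m k @ [r] = [] @ desc m r" using desc_snoc[of r m] r by simp
    then show ?thesis using r by (metis cox.refl empty_set empty_subsetI le_SucI)
  next
    case 3
    have "cox m (desc m k @ [r]) ([] @ desc m (Suc k))"
      using cox.square[of r m "desc m (Suc k)" "[]"] 3 r desc_snoc[of k m] by simp
    then show ?thesis using 3 r by (intro exI[of _ "[]"] exI[of _ "Suc k"]) auto
  next
    case 4
    \<comment> \<open>The word has the shape \<open>?A @ r # s # B\<close>. The new \<open>r\<close>
      commutes past \<open>B\<close>, the braid relation turns \<open>r, s, r\<close> into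
      \<open>s, r, s\<close>, and the leading \<open>s\<close> commutes past
      \<open>?A\<close>.\<close>
    define s where "s = r - 1"
    have rs: "r = Suc s" "1 \<le> s" "k \<le> s" using 4 k by (auto simp: s_def)
    let ?A = "desc m (Suc r)"
    define B where "B = rev [k..<s]"
    have B: "desc s k = s # B" "set B \<subseteq> {k..<s}" using rs by (auto simp: B_def desc_def)
    have D: "desc m k = ?A @ r # s # B"
      using desc_split[of k r m] desc_split[of k s r] rs r 4 B(1) desc_snoc[of r r] desc_empty[of r] by simp
    have cB: "cox m (B @ [r]) (r # B)"
      using cox_far_list[of r m B] B(2) rs r k by fastforce
    have cA: "cox m (?A @ [s]) (s # ?A)"
      using cox_far_list[of s m ?A] rs r by (auto simp: set_desc)
    have "cox m (desc m k @ [r]) (?A @ [r, s] @ r # B)"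
      using cox_append[OF cox.refl[of m "?A @ [r, s]"] cB] D by simp
    also have "cox m \<dots> (?A @ s # r # s # B)"
      using cox.sym[OF cox.braid[of s m "?A" B]] rs r by simp
    also have "cox m \<dots> ([s] @ ?A @ r # s # B)"
      using cox_append[OF cA cox.refl[of m "r # s # B"]] by simp
    finally show ?thesis using D rs r k by (intro exI[of _ "[s]"] exI[of _ k]) auto
  qed
qed

lemma cox_normal_form:
  assumes m: "1 \<le> m" and "set w \<subseteq> {1..m}"
  shows "\<exists>v k. set v \<subseteq> {1..m - 1} \<and> 1 \<le> k \<and> k \<le> Suc m \<and> cox m w (v @ desc m k)"
  using assms(2)
proof (induction w rule: rev_induct)
  case Nil
  show ?case by (intro exI[of _ "[]"] exI[of _ "Suc m"]) (auto simp: desc_empty cox.refl)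
next
  case (snoc r w)
  then obtain v k where v: "set v \<subseteq> {1..m - 1}" "1 \<le> k" "k \<le> Suc m" "cox m w (v @ desc m k)"
    by auto
  obtain v' k' where v': "set v' \<subseteq> {1..m - 1}" "1 \<le> k'" "k' \<le> Suc m"
    "cox m (desc m k @ [r]) (v' @ desc m k')"
    using desc_times_letter[OF m v(2,3), of r] snoc.prems by auto
  have "cox m (w @ [r]) (v @ desc m k @ [r])"
    using cox_append[OF v(4) cox.refl[of m "[r]"]] by simp
  also have "cox m \<dots> ((v @ v') @ desc m k')"
    using cox_append[OF cox.refl[of m v] v'(4)] by simp
  finally show ?case using v v' by (intro exI[of _ "v @ v'"] exI[of _ k']) auto
qed

text \<open>In the normal form \<open>v @ desc m k\<close> the first factor fixes
  \<open>Suc m\<close>, so \<open>k\<close> is the image of \<open>Suc m\<close>. Equal permutations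
  therefore have the same tail; cancelling it leaves words in fewer letters.\<close>

theorem coxeter_presentation:
  assumes "set u \<subseteq> {1..m}" "set v \<subseteq> {1..m}" "perm_of u = perm_of v"
  shows "cox m u v"
  using assms
proof (induction m arbitrary: u v)
  case 0
  then show ?case by (simp add: cox.refl)
next
  case (Suc m)
  let ?m = "Suc m"
  obtain u' k where u: "set u' \<subseteq> {1..m}" "1 \<le> k" "k \<le> Suc ?m" "cox ?m u (u' @ desc ?m k)"
    using cox_normal_form[of ?m u] Suc.prems by auto
  obtain v' l where v: "set v' \<subseteq> {1..m}" "1 \<le> l" "l \<le> Suc ?m" "cox ?m v (v' @ desc ?m l)"
    using cox_normal_form[of ?m v] Suc.prems by auto
  have pu: "perm_of u = perm_of (desc ?m k) \<circ> perm_of u'"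
    and pv: "perm_of v = perm_of (desc ?m l) \<circ> perm_of v'"
    using cox_perm_of[OF u(4)] cox_perm_of[OF v(4)] by (simp_all add: perm_of_append)
  have fixes_top: "perm_of x (Suc ?m) = Suc ?m" if "set x \<subseteq> {1..m}" for x
    using perm_of_permutes[OF that] by (auto simp: permutes_def)
  have "perm_of u (Suc ?m) = k" "perm_of v (Suc ?m) = l"
    using perm_of_desc u v fixes_top by (simp_all add: pu pv)
  then have kl: "k = l" using Suc.prems by simp
  have "inj (perm_of (desc ?m k))"
    using perm_of_permutes[of "desc ?m k" ?m] u by (auto simp: set_desc permutes_inj)
  then have "perm_of u' = perm_of v'"
    using pu pv kl Suc.prems(3) by (auto simp: fun_eq_iff inj_def)
  then have "cox ?m u' v'" using Suc.IH[OF u(1) v(1)] cox_mono by auto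
  then have "cox ?m (u' @ desc ?m k) (v' @ desc ?m l)"
    using kl cox_append cox.refl by blast
  then show ?case using u(4) v(4) by (meson cox.sym cox.trans)
qed

text \<open>Dividing by the coset representative with the same image of the largest point leaves a
  permutation that fixes this point.\<close>

lemma permutes_perm_of:
  assumes "f permutes {1..Suc m}"
  shows "\<exists>w. set w \<subseteq> {1..m} \<and> perm_of w = f"
  using assms
proof (induction m arbitrary: f)
  case 0
  then have "f = id" using permutes_sing[of f 1] by simp
  then show ?case by (intro exI[of _ "[]"]) auto
next
  case (Suc m)
  define k where "k = f (Suc (Suc m))"
  have k: "1 \<le> k" "k \<le> Suc (Suc m)"
    using permutes_in_image[OF Suc.prems, of "Suc (Suc m)"] by (auto simp: k_def)
  let ?d = "perm_of (desc (Suc m) k)"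
  have d: "?d permutes {1..Suc (Suc m)}"
    using perm_of_permutes[of "desc (Suc m) k" "Suc m"] k by (auto simp: set_desc)
  define g where "g = inv ?d \<circ> f"
  have "g permutes {1..Suc (Suc m)}"
    unfolding g_def by (intro permutes_compose[OF Suc.prems] permutes_inv[OF d])
  moreover have "g (Suc (Suc m)) = Suc (Suc m)"
    unfolding g_def using perm_of_desc[OF k] permutes_inverses(2)[OF d]
    by (metis comp_apply k_def)
  ultimately have "g permutes {1..Suc m}"
    by (elim permutes_superset) (auto simp: le_Suc_eq)
  then obtain w where w: "set w \<subseteq> {1..m}" "perm_of w = g" using Suc.IH by blast
  have "perm_of (w @ desc (Suc m) k) = f"
    using permutes_inverses(1)[OF d] by (auto simp: perm_of_append w g_def fun_eq_iff)
  then show ?case using w k by (intro exI[of _ "w @ desc (Suc m) k"]) (auto simp: set_desc)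
qed

section \<open>Lifting the Coxeter relations and completeness\<close>

lemma Zseq_append: "Zseq i j (u @ v) = Zseq i j u @ Zseq (perm_of u i) (perm_of u j) v"
  by (induction u arbitrary: i j) auto

lemma idx_perm_of: "set u \<subseteq> {1..n - 1} \<Longrightarrow> idx n i j \<Longrightarrow> idx n (perm_of u i) (perm_of u j)"
proof (induction u arbitrary: i j)
  case (Cons r u)
  then have "r_ok n r" "set u \<subseteq> {1..n - 1}" by auto
  then show ?case using Cons.IH[OF _ idx_st[OF _ Cons.prems(2)]] by (simp del: One_nat_def)
qed simp

text \<open>Passing the letters from right to left undoes the transport of the pair, one
  transposition at a time.\<close>

lemma Zseq_E:
  assumes "set u \<subseteq> {1..n - 1}" "idx n i j"
  shows "wcong n (Zseq i j u @ [E' (perm_of u i) (perm_of u j)]) (E' i j # Zseq i j u)"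
  using assms
proof (induction u arbitrary: i j)
  case (Cons r u)
  let ?i = "st r i" and ?j = "st r j"
  have r: "r_ok n r" and ij: "idx n i j" using Cons.prems by auto
  have ij': "idx n ?i ?j" by (rule idx_st[OF r ij])
  have "wcong n (Z' r i j # Zseq ?i ?j u @ [E' (perm_of u ?i) (perm_of u ?j)])
      (Z' r i j # E' ?i ?j # Zseq ?i ?j u)"
    using Cons.IH[OF _ ij'] Cons.prems by (intro wcong_Cons) auto
  also have "wcong n \<dots> (E' i j # Z' r i j # Zseq ?i ?j u)"
    using wcong_pre2[OF Z_mult_E[OF r ij ij']] by simp
  finally show ?case by simp
qed (simp add: wcong.refl)

text \<open>The braid and commutation rules lift to (b) and (c). The rule \<open>r r = 1\<close>
  lifts only to an idempotent, since there is no identity; that idempotent returns to the front and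
  is absorbed by the leading \<open>E' i j\<close>.\<close>

lemma Zseq_cox:
  assumes "cox (n - 1) u v" "set u \<subseteq> {1..n - 1}" "idx n i j"
  shows "wcong n (E' i j # Zseq i j u) (E' i j # Zseq i j v)"
  using assms(1,2)
proof (induction rule: cox.induct)
  case (braid r x y)
  have r: "r_ok n r" "r_ok n (r + 1)" and x: "set x \<subseteq> {1..n - 1}" using braid by auto
  have "wcong n (Zseq (perm_of x i) (perm_of x j) [r, r + 1, r])
      (Zseq (perm_of x i) (perm_of x j) [r + 1, r, r + 1])"
    using Z_braid[OF r _ idx_perm_of[OF x assms(3)]] by simp
  \<comment> \<open>Both sides move the pair alike, so the letters that follow carry the same
    indices.\<close>
  moreover have "perm_of [r, r + 1, r] = perm_of [r + 1, r, r + 1]"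
    using cox_perm_of[OF cox.braid[OF braid.hyps, of "[]" "[]"]] by simp
  ultimately show ?case
    unfolding Zseq_append
    by (intro wcong_Cons wcong_append_left) (simp only: wcong_append_right)
next
  case (far r t x y)
  have r: "r_ok n r" "r_ok n t" and x: "set x \<subseteq> {1..n - 1}" using far by auto
  have "wcong n (Zseq (perm_of x i) (perm_of x j) [r, t])
      (Zseq (perm_of x i) (perm_of x j) [t, r])"
    using Z_far[OF r _ idx_perm_of[OF x assms(3)]] far.hyps by simp
  moreover have "perm_of [r, t] = perm_of [t, r]"
    using cox_perm_of[OF cox.far[OF far.hyps, of "[]" "[]"]] by simp
  ultimately show ?case
    unfolding Zseq_append
    by (intro wcong_Cons wcong_append_left) (simp only: wcong_append_right)
next
  case (square r x y)
  let ?i = "perm_of x i" and ?j = "perm_of x j"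
  have x: "set x \<subseteq> {1..n - 1}" and r: "r_ok n r" using square by auto
  have ij: "idx n ?i ?j" using idx_perm_of[OF x assms(3)] .
  have "wcong n [Z' r ?i ?j, Z' r (st r ?i) (st r ?j)] [E' ?i ?j]"
    using wcong.trans[OF Z_mult_Z[OF r ij idx_st[OF r ij]]] E_idem[OF ij] by simp
  then have "wcong n (E' i j # Zseq i j x @ [Z' r ?i ?j, Z' r (st r ?i) (st r ?j)] @ Zseq ?i ?j y)
      (E' i j # Zseq i j x @ [E' ?i ?j] @ Zseq ?i ?j y)"
    by (intro wcong_Cons wcong_append_left wcong_append_right)
  also have "wcong n \<dots> (E' i j # E' i j # Zseq i j x @ Zseq ?i ?j y)"
    using wcong_Cons[OF wcong_append_right[OF Zseq_E[OF x assms(3)]]] by simp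
  also have "wcong n \<dots> (E' i j # Zseq i j x @ Zseq ?i ?j y)"
    using wcong_pre2[OF E_idem[OF assms(3)]] by simp
  finally show ?case by (simp add: Zseq_append)
next
  case (sym u v)
  then show ?case using cox_range wcong.sym by blast
next
  case (trans u v w)
  then show ?case using cox_range wcong.trans by blast
qed (rule wcong.refl)

text \<open>A single pair from the common equivalence relation serves both normal forms, which are
  then compared factor by factor.\<close>

theorem wcong_complete:
  assumes w: "set w \<subseteq> gens n" "w \<noteq> []" and w': "set w' \<subseteq> gens n" "w' \<noteq> []"
    and Eqv: "Eqv (set (pair_list w)) = Eqv (set (pair_list w'))"
    and perm: "perm_of (perm_word w) = perm_of (perm_word w')"
  shows "wcong n w w'"
proof -
  have L: "idxs n (pair_list w)" "idxs n (pair_list w')" using pair_list_idxs w w' by auto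
  obtain i j where p: "(i, j) \<in> set (pair_list w)"
  proof -
    obtain g v where "w = g # v" using w(2) by (cases w) auto
    then show ?thesis using that by (cases g) auto
  qed
  then have ij: "idx n i j" "i \<noteq> j" and mem: "(i, j) \<in> Eqv (set (pair_list w))"
    using L(1) subset_Eqv by auto
  let ?Z = "\<lambda>w. Zseq i j (perm_word w)"
  have L': "idxs n ((i, j) # pair_list w)" "idxs n ((i, j) # pair_list w')" using L ij(1) by auto
  have "wcong n w (E' i j # Ew (pair_list w) @ ?Z w)"
    by (rule normal_form_Eqv[OF w mem ij(2)])
  also have "wcong n \<dots> (E' i j # Ew (pair_list w') @ ?Z w)"
  proof -
    have "wcong n (Ew (pair_list w)) (Ew (pair_list w'))"
      by (rule Ew_eq[OF L Eqv])
    then show ?thesis by (intro wcong_Cons wcong_append_right)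
  qed
  \<comment> \<open>The lift can be rewritten only behind an idempotent for its starting
    pair.\<close>
  also have "wcong n \<dots> (Ew (pair_list w') @ E' i j # ?Z w)"
    using wcong_append_right[OF E_move_Ew[OF ij(1) L(2)]] by simp
  also have "wcong n \<dots> (Ew (pair_list w') @ E' i j # ?Z w')"
    using coxeter_presentation[OF perm_word_range perm_word_range perm] w w' ij(1)
    by (intro wcong_append_left Zseq_cox perm_word_range)
  also have "wcong n \<dots> (E' i j # Ew (pair_list w') @ ?Z w')"
    using wcong.sym[OF wcong_append_right[OF E_move_Ew[OF ij(1) L(2)]]] by simp
  also have "wcong n \<dots> w'"
    using normal_form_Eqv[OF w' _ ij(2)] mem Eqv by (auto intro: wcong.sym)
  finally show ?thesis .
qed

section \<open>The partition model\<close>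

lemma equiv_Eqv: "equiv UNIV (Eqv S)"
  unfolding Eqv_def
  by (intro equivI) (auto intro: refl_rtrancl sym_rtrancl sym_Un_converse trans_rtrancl)

lemma Eqv_eqI: "S \<subseteq> Eqv T \<Longrightarrow> T \<subseteq> Eqv S \<Longrightarrow> Eqv S = Eqv T"
proof -
  have "Eqv S \<subseteq> Eqv T" if "S \<subseteq> Eqv T" for S T :: "('a \<times> 'a) set"
  proof -
    have "S \<union> S\<inverse> \<subseteq> Eqv T"
      using that equiv_Eqv[of T] by (auto simp: equiv_def dest: symD)
    then show ?thesis unfolding Eqv_def by (rule rtrancl_subset_rtrancl)
  qed
  then show "S \<subseteq> Eqv T \<Longrightarrow> T \<subseteq> Eqv S \<Longrightarrow> Eqv S = Eqv T" by blast
qed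

text \<open>The closure on the left is the join of two equivalence relations, which is what
  concatenation of diagrams produces.\<close>

lemma Eqv_Un: "(Eqv S \<union> Eqv T)\<^sup>* = Eqv (S \<union> T)"
  unfolding Eqv_def rtrancl_Un_rtrancl converse_Un by (simp add: Un_ac)

lemma Eqv_inv_image:
  assumes "bij f"
  shows "inv_image (Eqv S) f = Eqv (inv_image S f)"
proof -
  have "(f a, f b) \<in> Eqv S" if "(a, b) \<in> Eqv (inv_image S f)" for a b
    using that unfolding Eqv_def
    by (induction rule: rtrancl_induct) (auto intro: rtrancl_into_rtrancl)
  \<comment> \<open>The intermediate points of a chain are pulled back by \<open>inv f\<close>,
    which needs \<open>f\<close> to be surjective.\<close>
  moreover have "(inv f x, inv f y) \<in> Eqv (inv_image S f)" if "(x, y) \<in> Eqv S" for x y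
    using that unfolding Eqv_def
  proof (induction rule: rtrancl_induct)
    case (step y z)
    then have "(inv f y, inv f z) \<in> inv_image S f \<union> (inv_image S f)\<inverse>"
      using assms by (auto simp: bij_is_surj surj_f_inv_f)
    then show ?case using step.IH by (meson rtrancl_into_rtrancl)
  qed simp
  ultimately show ?thesis
    using assms by (auto simp: bij_is_inj) (metis assms bij_is_inj inv_f_f)
qed

text \<open>An element of \<open>R(S\<^sub>n)\<close> is encoded by a permutation \<open>f\<close> and an equivalence relation \<open>K\<close>
  on the top points, extended by equality to all natural numbers: the bottom point \<open>n + f k\<close>
  is identified with its partner \<open>k\<close>.\<close>

definition eqv_on :: "nat \<Rightarrow> (nat \<times> nat) set \<Rightarrow> bool" where
  "eqv_on n K \<longleftrightarrow> equiv UNIV K \<and> K \<subseteq> Id \<union> {1..n} \<times> {1..n}"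

definition top_of :: "nat \<Rightarrow> (nat \<Rightarrow> nat) \<Rightarrow> nat \<Rightarrow> nat" where
  "top_of n f x = (if x \<le> n then x else inv f (x - n))"

definition prel :: "nat \<Rightarrow> (nat \<times> nat) set \<Rightarrow> (nat \<Rightarrow> nat) \<Rightarrow> (nat \<times> nat) set" where
  "prel n K f = {(x, y). x \<in> {1..2*n} \<and> y \<in> {1..2*n} \<and> (top_of n f x, top_of n f y) \<in> K}"

definition part :: "nat \<Rightarrow> (nat \<times> nat) set \<Rightarrow> (nat \<Rightarrow> nat) \<Rightarrow> nat set set" where
  "part n K f = {1..2*n} // prel n K f"

lemma eqv_on_refl: "eqv_on n K \<Longrightarrow> (a, a) \<in> K"
  by (auto simp: eqv_on_def equiv_def refl_on_def)

lemma eqv_on_sym: "eqv_on n K \<Longrightarrow> (a, b) \<in> K \<Longrightarrow> (b, a) \<in> K"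
  by (auto simp: eqv_on_def equiv_def dest: symD)

lemma eqv_on_trans: "eqv_on n K \<Longrightarrow> (a, b) \<in> K \<Longrightarrow> (b, c) \<in> K \<Longrightarrow> (a, c) \<in> K"
  by (auto simp: eqv_on_def equiv_def dest: transD)

lemma eqv_on_range: "eqv_on n K \<Longrightarrow> (a, b) \<in> K \<Longrightarrow> a \<in> {1..n} \<Longrightarrow> b \<in> {1..n}"
  by (auto simp: eqv_on_def)

lemma eqv_on_Id: "eqv_on n Id"
  by (auto simp: eqv_on_def equiv_def refl_on_def sym_def trans_def)

lemma eqv_on_Eqv: "S \<subseteq> {1..n} \<times> {1..n} \<Longrightarrow> eqv_on n (Eqv S)"
proof -
  assume S: "S \<subseteq> {1..n} \<times> {1..n}"
  have "(a, b) \<in> Id \<union> {1..n} \<times> {1..n}" if "(a, b) \<in> Eqv S" for a b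
    using that unfolding Eqv_def by (induction rule: rtrancl_induct) (use S in auto)
  then have "Eqv S \<subseteq> Id \<union> {1..n} \<times> {1..n}" by (rule subrelI)
  then show ?thesis unfolding eqv_on_def using equiv_Eqv by blast
qed

lemma top_of_top: "k \<in> {1..n} \<Longrightarrow> top_of n f k = k"
  by (simp add: top_of_def)

lemma top_of_bottom: "f permutes {1..n} \<Longrightarrow> k \<in> {1..n} \<Longrightarrow> top_of n f (n + f k) = k"
  using permutes_in_image[of f "{1..n}" k] by (auto simp: top_of_def permutes_inverses)

lemma bottom_range: fixes n :: nat shows "f permutes {1..n} \<Longrightarrow> k \<in> {1..n} \<Longrightarrow> n + f k \<in> {1..2*n}"
  using permutes_in_image[of f "{1..n}" k] by auto

lemma point_cases:
  fixes n :: nat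
  assumes "f permutes {1..n}" "x \<in> {1..2*n}"
  obtains "x \<in> {1..n}" | k where "k \<in> {1..n}" "x = n + f k"
proof (cases "x \<le> n")
  case False
  then have "x - n \<in> {1..n}" using assms(2) by auto
  then have "inv f (x - n) \<in> {1..n}" "x = n + f (inv f (x - n))"
    using False permutes_in_image[OF permutes_inv[OF assms(1)], of "x - n"]
    by (simp_all add: permutes_inverses[OF assms(1)])
  then show ?thesis by (rule that(2))
qed (use that assms in auto)

lemma top_of_range:
  assumes "f permutes {1..n}" "x \<in> {1..2*n}"
  shows "top_of n f x \<in> {1..n}"
  using assms by (cases rule: point_cases) (simp_all only: top_of_top top_of_bottom[OF assms(1)])

lemma equiv_prel: "eqv_on n K \<Longrightarrow> equiv {1..2*n} (prel n K f)"
  unfolding prel_def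
  by (intro equivI refl_onI symI transI) (auto intro: eqv_on_refl eqv_on_sym eqv_on_trans)

lemma part_iff:
  assumes "eqv_on n K"
  shows "(\<exists>B \<in> part n K f. x \<in> B \<and> y \<in> B) \<longleftrightarrow> (x, y) \<in> prel n K f"
proof
  assume "\<exists>B \<in> part n K f. x \<in> B \<and> y \<in> B"
  then show "(x, y) \<in> prel n K f"
    using in_quotient_imp_in_rel[OF equiv_prel[OF assms]] unfolding part_def by blast
next
  assume xy: "(x, y) \<in> prel n K f"
  then have x: "x \<in> {1..2*n}" by (auto simp: prel_def)
  then show "\<exists>B \<in> part n K f. x \<in> B \<and> y \<in> B"
    unfolding part_def using xy equiv_class_self[OF equiv_prel[OF assms] x]
    by (intro bexI[of _ "prel n K f `` {x}"] quotientI) auto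
qed

lemma part_eq_image:
  "part n K f = (\<lambda>x. {y \<in> {1..2*n}. (top_of n f x, top_of n f y) \<in> K}) ` {1..2*n}"
proof -
  have "prel n K f `` {x} = {y \<in> {1..2*n}. (top_of n f x, top_of n f y) \<in> K}"
    if "x \<in> {1..2*n}" for x using that by (auto simp: prel_def)
  then show ?thesis unfolding part_def quotient_def by (auto simp: image_iff)
qed

lemma setpart_part: "eqv_on n K \<Longrightarrow> setpart n (part n K f)"
  unfolding setpart_def part_def by (intro partition_on_quotient equiv_prel)

text \<open>Every point lies in the block of its top partner, so the top points index all blocks.
  This form makes the partitions comparable with those given by explicit blocks.\<close>

lemma part_blocks:
  assumes K: "eqv_on n K" and f: "f permutes {1..n}"
  shows "part n K f = (\<lambda>i. K `` {i} \<union> (\<lambda>k. n + f k) ` (K `` {i})) ` {1..n}"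
proof -
  have cls: "prel n K f `` {i} = K `` {i} \<union> (\<lambda>k. n + f k) ` (K `` {i})" if i: "i \<in> {1..n}" for i
  proof (intro set_eqI iffI)
    fix y assume "y \<in> prel n K f `` {i}"
    then have y: "y \<in> {1..2*n}" "(i, top_of n f y) \<in> K" using i by (auto simp: prel_def top_of_def)
    from f y(1) show "y \<in> K `` {i} \<union> (\<lambda>k. n + f k) ` (K `` {i})"
      by (cases rule: point_cases) (use y f in \<open>auto simp: top_of_top top_of_bottom\<close>)
  next
    fix y assume "y \<in> K `` {i} \<union> (\<lambda>k. n + f k) ` (K `` {i})"
    then obtain k where k: "(i, k) \<in> K" "y = k \<or> y = n + f k" by auto
    then have "k \<in> {1..n}" using eqv_on_range[OF K] i by blast
    then have "y \<in> {1..2*n}" "top_of n f y = k"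
      using k(2) top_of_top top_of_bottom[OF f] bottom_range[OF f] by auto
    then show "y \<in> prel n K f `` {i}" using k i by (auto simp: prel_def top_of_top)
  qed
  have "part n K f = (\<lambda>x. prel n K f `` {x}) ` {1..2*n}"
    unfolding part_def quotient_def by auto
  also have "\<dots> = (\<lambda>x. prel n K f `` {top_of n f x}) ` {1..2*n}"
  proof (rule image_cong)
    fix x assume x: "x \<in> {1..2*n}"
    show "prel n K f `` {x} = prel n K f `` {top_of n f x}"
      using x top_of_range[OF f x] by (auto simp: prel_def top_of_top)
  qed simp
  also have "\<dots> = (\<lambda>i. prel n K f `` {i}) ` {1..n}"
  proof -
    have "top_of n f ` {1..2*n} = {1..n}"
    proof
      show "top_of n f ` {1..2*n} \<subseteq> {1..n}" using top_of_range[OF f] by blast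
      show "{1..n} \<subseteq> top_of n f ` {1..2*n}"
      proof
        fix k assume "k \<in> {1..n}"
        then have "k = top_of n f k" "k \<in> {1..2*n}" by (auto simp: top_of_top)
        then show "k \<in> top_of n f ` {1..2*n}" by (rule image_eqI)
      qed
    qed
    then show ?thesis
      using image_image[of "\<lambda>i. prel n K f `` {i}" "top_of n f" "{1..2*n}", symmetric] by simp
  qed
  also have "\<dots> = (\<lambda>i. K `` {i} \<union> (\<lambda>k. n + f k) ` (K `` {i})) ` {1..n}"
    by (rule image_cong) (simp_all only: cls)
  finally show ?thesis .
qed

text \<open>On top points \<open>prel\<close> restricts to the given relation, and elsewhere both
  relations are equality.\<close>

lemma part_inject:
  assumes "eqv_on n K" "eqv_on n F" "f permutes {1..n}" "part n K f = part n F f"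
  shows "K = F"
proof -
  have "prel n K f = prel n F f"
    using part_iff[OF assms(1), of f] part_iff[OF assms(2), of f] assms(4) by auto
  then have "(a, b) \<in> K \<longleftrightarrow> (a, b) \<in> F" if "a \<in> {1..n}" "b \<in> {1..n}" for a b
  proof -
    have *: "(a, b) \<in> R \<longleftrightarrow> (a, b) \<in> prel n R f" for R
      using that by (auto simp: prel_def top_of_top)
    show ?thesis using \<open>prel n K f = prel n F f\<close> *[of K] *[of F] by simp
  qed
  moreover have "a = b \<or> a \<in> {1..n} \<and> b \<in> {1..n}" if "(a, b) \<in> K \<union> F" for a b
    using that assms(1,2) by (auto simp: eqv_on_def)
  ultimately have "(a, b) \<in> K \<longleftrightarrow> (a, b) \<in> F" for a b
    using eqv_on_refl[OF assms(1)] eqv_on_refl[OF assms(2)] by blast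
  then show ?thesis by auto
qed

lemma part_Id_inject:
  assumes f: "f permutes {1..n}" and g: "g permutes {1..n}" and eq: "part n Id f = part n Id g"
  shows "f = g"
proof
  fix i
  show "f i = g i"
  proof (cases "i \<in> {1..n}")
    case True
    have "(i, n + f i) \<in> prel n Id f"
      using True f bottom_range[OF f True] by (auto simp: prel_def top_of_top top_of_bottom)
    then have "(i, n + f i) \<in> prel n Id g"
      using part_iff[OF eqv_on_Id, of n f] part_iff[OF eqv_on_Id, of n g] eq by simp
    then have "inv g (f i) = i"
      using permutes_in_image[OF f, of i] True by (auto simp: prel_def top_of_def)
    then show ?thesis using permutes_inverses(1)[OF g] by metis
  qed (use f g in \<open>auto simp: permutes_def\<close>)
qed

lemma cstep_part:
  assumes "eqv_on n K" "eqv_on n F"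
  shows "cstep n (part n K f) (part n F g) p q \<longleftrightarrow>
    (\<exists>x y. (x, y) \<in> prel n K f \<and> p = pos_up n x \<and> q = pos_up n y) \<or>
    (\<exists>x y. (x, y) \<in> prel n F g \<and> p = pos_low n x \<and> q = pos_low n y)"
  unfolding cstep_def part_iff[OF assms(1), symmetric] part_iff[OF assms(2), symmetric] by blast

text \<open>Every vertex of the stacked diagram is connected to exactly one top point through the
  permutations alone, so connectivity can be read off the top points.\<close>

lemma pmul_part:
  assumes K: "eqv_on n K" and F: "eqv_on n F" and f: "f permutes {1..n}" and g: "g permutes {1..n}"
  shows "pmul n (part n K f) (part n F g) = part n ((K \<union> inv_image F f)\<^sup>*) (g \<circ> f)"
proof -
  let ?T = "(K \<union> inv_image F f)\<^sup>*"
  let ?c = "cstep n (part n K f) (part n F g)"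
  have gf: "g \<circ> f permutes {1..n}" by (rule permutes_compose[OF f g])
  have inv_gf: "inv (g \<circ> f) = inv f \<circ> inv g"
    using permutes_bij[OF f] permutes_bij[OF g] by (simp add: o_inv_distrib)
  \<comment> \<open>\<open>lv\<close> takes a vertex of level 0, 1 or 2 to the top point it is
    joined to by the permutations.\<close>
  define lv where "lv = (\<lambda>(l::nat, x). if l = 0 then x else if l = 1 then inv f x else inv f (inv g x))"
  have lv_up: "lv (pos_up n x) = top_of n f x"
    and lv_low: "lv (pos_low n x) = inv f (top_of n g x)"
    and lv_out: "lv (pos_out n x) = top_of n (g \<circ> f) x" for x
    by (auto simp: lv_def pos_up_def pos_low_def pos_out_def top_of_def inv_gf)
  note c_iff = cstep_part[OF K F, of f g]
  \<comment> \<open>Under \<open>lv\<close> an edge of the upper diagram becomes a pair of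
    \<open>K\<close>, and one of the lower diagram a pair of the preimage of
    \<open>F\<close>.\<close>
  have fwd: "(lv p, lv q) \<in> ?T" if "?c\<^sup>*\<^sup>* p q" for p q
    using that
  proof (induction rule: rtranclp_induct)
    case (step q s)
    have "(lv q, lv s) \<in> K \<union> inv_image F f"
      using step.hyps(2) unfolding c_iff
      by (auto simp: lv_up lv_low prel_def permutes_inverses[OF f])
    then show ?case using step.IH by (meson rtrancl_into_rtrancl)
  qed simp
  have up: "?c (pos_up n x) (pos_up n y)" if "(x, y) \<in> prel n K f" for x y
    using that c_iff by blast
  have low: "?c (pos_low n x) (pos_low n y)" if "(x, y) \<in> prel n F g" for x y
    using that c_iff by blast
  have symc: "?c\<^sup>*\<^sup>* q p" if "?c\<^sup>*\<^sup>* p q" for p q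
  proof -
    have "(y, x) \<in> prel n K f" if "(x, y) \<in> prel n K f" for x y
      using that eqv_on_sym[OF K] by (auto simp: prel_def)
    moreover have "(y, x) \<in> prel n F g" if "(x, y) \<in> prel n F g" for x y
      using that eqv_on_sym[OF F] by (auto simp: prel_def)
    ultimately have "symp ?c" unfolding c_iff by (intro sympI) blast
    then show ?thesis using that symp_rtranclp sympD by metis
  qed
  have f_in: "f k \<in> {1..n}" if "k \<in> {1..n}" for k using permutes_in_image[OF f] that by blast
  have mid: "?c (0, k) (1, f k)" if k: "k \<in> {1..n}" for k
  proof -
    have "(k, n + f k) \<in> prel n K f"
      using k bottom_range[OF f k] eqv_on_refl[OF K]
      by (auto simp: prel_def top_of_top top_of_bottom[OF f])
    from up[OF this] show ?thesis using k f_in[OF k] by (simp add: pos_up_def)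
  qed
  have conn: "?c\<^sup>*\<^sup>* (0, top_of n (g \<circ> f) x) (pos_out n x)" if x: "x \<in> {1..2*n}" for x
    using gf x
  proof (cases rule: point_cases)
    case 1
    then show ?thesis by (simp add: top_of_top pos_out_def)
  next
    case (2 k)
    have "(f k, n + g (f k)) \<in> prel n F g"
      using f_in[OF 2(1)] bottom_range[OF g, of "f k"] eqv_on_refl[OF F]
      by (auto simp: prel_def top_of_top top_of_bottom[OF g])
    from low[OF this] have "?c (1, f k) (2, g (f k))"
      using f_in[OF 2(1)] permutes_in_image[OF g, of "f k"] by (simp add: pos_low_def)
    then have "?c\<^sup>*\<^sup>* (0, k) (2, g (f k))" using mid[OF 2(1)] by (meson converse_rtranclp_into_rtranclp r_into_rtranclp)
    moreover have "pos_out n x = (2, g (f k))"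
      using permutes_in_image[OF gf, of k] 2 by (simp add: pos_out_def)
    ultimately show ?thesis using top_of_bottom[OF gf 2(1)] 2(2) by simp
  qed
  have bwd: "?c\<^sup>*\<^sup>* (0, a) (0, b) \<and> b \<in> {1..n}" if "(a, b) \<in> ?T" "a \<in> {1..n}" for a b
    using that(1)
  proof (induction rule: rtrancl_induct)
    case (step b d)
    then have b: "b \<in> {1..n}" by simp
    from step.hyps(2) have "?c\<^sup>*\<^sup>* (0, b) (0, d) \<and> d \<in> {1..n}"
    proof
      assume bd: "(b, d) \<in> K"
      have d: "d \<in> {1..n}" by (rule eqv_on_range[OF K bd b])
      have "(b, d) \<in> prel n K f" using b d bd by (auto simp: prel_def top_of_top)
      from up[OF this] show ?thesis using b d by (auto simp: pos_up_def)
    next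
      \<comment> \<open>Such a pair is realised by going down to the middle row, along an edge of
        the lower diagram, and up again.\<close>
      assume "(b, d) \<in> inv_image F f"
      then have bd: "(f b, f d) \<in> F" by simp
      then have fd: "f d \<in> {1..n}" using eqv_on_range[OF F] f_in[OF b] by blast
      then have d: "d \<in> {1..n}" using permutes_in_image[OF f] by blast
      have "(f b, f d) \<in> prel n F g" using f_in[OF b] fd bd by (auto simp: prel_def top_of_top)
      from low[OF this] have "?c (1, f b) (1, f d)"
        using f_in[OF b] fd by (auto simp: pos_low_def)
      then have "?c\<^sup>*\<^sup>* (0, b) (1, f d)"
        using mid[OF b] by (meson converse_rtranclp_into_rtranclp r_into_rtranclp)
      moreover have "?c\<^sup>*\<^sup>* (1, f d) (0, d)" using mid[OF d] symc by blast
      ultimately show ?thesis using d by (meson rtranclp_trans)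
    qed
    then show ?case using step.IH by (meson rtranclp_trans)
  qed (use that in simp)
  have "?c\<^sup>*\<^sup>* (pos_out n x) (pos_out n y) \<longleftrightarrow> (top_of n (g \<circ> f) x, top_of n (g \<circ> f) y) \<in> ?T"
    if "x \<in> {1..2*n}" "y \<in> {1..2*n}" for x y
  proof
    assume "?c\<^sup>*\<^sup>* (pos_out n x) (pos_out n y)"
    from fwd[OF this] show "(top_of n (g \<circ> f) x, top_of n (g \<circ> f) y) \<in> ?T" by (simp only: lv_out)
  next
    assume "(top_of n (g \<circ> f) x, top_of n (g \<circ> f) y) \<in> ?T"
    from bwd[OF this top_of_range[OF gf that(1)]]
    show "?c\<^sup>*\<^sup>* (pos_out n x) (pos_out n y)"
      using conn[OF that(1)] conn[OF that(2)] symc by (meson rtranclp_trans)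
  qed
  then have "pmul n (part n K f) (part n F g) =
      (\<lambda>x. {y \<in> {1..2*n}. (top_of n (g \<circ> f) x, top_of n (g \<circ> f) y) \<in> ?T}) ` {1..2*n}"
    unfolding pmul_def by (intro image_cong refl Collect_cong conj_cong) auto
  then show ?thesis by (simp only: part_eq_image)
qed

section \<open>Evaluation of words in closed form\<close>

text \<open>Unlike \<open>evalw\<close>, this has a useful value on the empty word, so
  multiplicativity holds for all lists of generators.\<close>

definition val :: "nat \<Rightarrow> gen list \<Rightarrow> nat set set \<times> nat set set" where
  "val n w = (part n Id (perm_of (perm_word w)),
    part n (Eqv (set (pair_list w))) (perm_of (perm_word w)))"

lemma perm_of_permutes': "set u \<subseteq> {1..n - 1} \<Longrightarrow> perm_of u permutes {1..n}"
  using perm_of_permutes[of u "n - 1"] by (cases n) (auto simp: permutes_id)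

lemma perm_word_permutes: "set w \<subseteq> gens n \<Longrightarrow> perm_of (perm_word w) permutes {1..n}"
  by (intro perm_of_permutes' perm_word_range)

lemma eqv_on_pair_list: "set w \<subseteq> gens n \<Longrightarrow> eqv_on n (Eqv (set (pair_list w)))"
  using pair_list_idxs[of w n] by (intro eqv_on_Eqv) auto

lemma perm_word_append: "perm_word (u @ v) = perm_word u @ perm_word v"
  by (induction u rule: perm_word.induct) auto

lemma map_prod_st_image: "map_prod (st r) (st r) ` S = inv_image S (st r)"
proof (intro set_eqI iffI)
  fix p assume "p \<in> inv_image S (st r)"
  then have "map_prod (st r) (st r) p \<in> S" by (cases p) auto
  then show "p \<in> map_prod (st r) (st r) ` S"
    by (intro image_eqI[of _ _ "map_prod (st r) (st r) p"]) (cases p, auto)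
qed auto

text \<open>The pairs of the right factor cross the permutation of the left one, hence the preimage;
  it is the one occurring in the product of partitions.\<close>

lemma set_pair_list_append:
  "set (pair_list (u @ v)) = set (pair_list u) \<union> inv_image (set (pair_list v)) (perm_of (perm_word u))"
  by (induction u rule: pair_list.induct)
    (auto simp: map_prod_st_image inv_image_def image_Un)

lemma rtrancl_Id_inv_image: "inj f \<Longrightarrow> (Id \<union> inv_image Id f)\<^sup>* = Id"
proof -
  assume "inj f"
  then have "inv_image Id f = Id" by (auto simp: inj_def)
  then show ?thesis using rtrancl_reflcl[of "{}"] by simp
qed

lemma val_append:
  assumes u: "set u \<subseteq> gens n" and v: "set v \<subseteq> gens n"
  shows "rmul n (val n u) (val n v) = val n (u @ v)"
proof -
  note fu = perm_word_permutes[OF u] and fv = perm_word_permutes[OF v]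
  show ?thesis
    unfolding val_def rmul_def fst_conv snd_conv
      pmul_part[OF eqv_on_Id eqv_on_Id fu fv]
      pmul_part[OF eqv_on_pair_list[OF u] eqv_on_pair_list[OF v] fu fv]
      Eqv_inv_image[OF permutes_bij[OF fu]] Eqv_Un rtrancl_Id_inv_image[OF permutes_inj[OF fu]]
      set_pair_list_append perm_word_append perm_of_append ..
qed

lemma one_part_eq: "one_part n = part n Id id"
  unfolding part_blocks[OF eqv_on_Id permutes_id] one_part_def by auto

lemma s_part_eq: "r_ok n r \<Longrightarrow> s_part n r = part n Id (st r)"
proof -
  assume "r_ok n r"
  then have "st r permutes {1..n}" using perm_of_permutes'[of "[r]" n] by simp
  from part_blocks[OF eqv_on_Id this] show ?thesis by (auto simp: s_part_def)
qed

lemma Eqv_single: "Eqv {(i, j)} `` {k} = (if k = i \<or> k = j then {i, j} else {k})"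
proof -
  let ?R = "{(a, b). a = b \<or> a \<in> {i, j} \<and> b \<in> {i, j}}"
  have "Eqv {(i, j)} \<subseteq> ?R"
  proof -
    have "(a, b) \<in> ?R" if "(a, b) \<in> Eqv {(i, j)}" for a b
      using that unfolding Eqv_def by (induction rule: rtrancl_induct) auto
    then show ?thesis by auto
  qed
  moreover have "?R \<subseteq> Eqv {(i, j)}"
    unfolding Eqv_def by (auto intro: r_into_rtrancl)
  ultimately have "Eqv {(i, j)} = ?R" by blast
  then show ?thesis by auto
qed

lemma J_part_eq:
  assumes "pair_ok n i j"
  shows "J_part n i j = part n (Eqv {(i, j)}) id"
proof -
  have K: "eqv_on n (Eqv {(i, j)})" using assms by (intro eqv_on_Eqv) auto
  let ?b = "\<lambda>k. Eqv {(i, j)} `` {k} \<union> (\<lambda>k. n + id k) ` (Eqv {(i, j)} `` {k})"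
  have "{1..n} = {i, j} \<union> ({1..n} - {i, j})" using assms by auto
  then have "part n (Eqv {(i, j)}) id = ?b ` {i, j} \<union> ?b ` ({1..n} - {i, j})"
    unfolding part_blocks[OF K permutes_id] by (simp only: image_Un[symmetric])
  also have "?b ` {i, j} = {{i, j, n + i, n + j}}"
    by (simp add: Eqv_single insert_commute)
  also have "?b ` ({1..n} - {i, j}) = (\<lambda>k. {k, n + k}) ` ({1..n} - {i, j})"
    by (rule image_cong) (auto simp: Eqv_single)
  finally have eq: "part n (Eqv {(i, j)}) id =
      {{i, j, n + i, n + j}} \<union> (\<lambda>k. {k, n + k}) ` ({1..n} - {i, j})" .
  show ?thesis unfolding eq J_part_def by auto
qed

lemma gen_val_eq:
  assumes "g \<in> gens n"
  shows "gen_val n g = val n [g]"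
proof -
  have e: "e_el n i j = val n [E i j]" if "pair_ok n i j" for i j
    using J_part_eq[OF that] by (simp add: e_el_def val_def one_part_eq)
  from assms show ?thesis
  proof (cases rule: gensE)
    case (1 i j)
    then show ?thesis using e by auto
  next
    case (2 r i j)
    have ij: "pair_ok n i j" using 2 by auto
    have s: "st r permutes {1..n}" using perm_of_permutes'[of "[r]" n] 2(3) by simp
    have K: "eqv_on n (Eqv {(i, j)})" using ij by (intro eqv_on_Eqv) auto
    have "(Eqv {(i, j)} \<union> inv_image Id id)\<^sup>* = Eqv {(i, j)}"
    proof -
      \<comment> \<open>The transposition contributes the equality relation, which is generated by
        no pairs.\<close>
      have "inv_image Id id = Eqv ({} :: (nat \<times> nat) set)" by (auto simp: Eqv_def)
      then show ?thesis using Eqv_Un[of "{(i, j)}" "{}"] by (simp only: Un_empty_right)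
    qed
    then show ?thesis
      using 2(1) e[OF ij] s_part_eq[OF 2(3)] pmul_part[OF eqv_on_Id eqv_on_Id permutes_id s]
        pmul_part[OF K eqv_on_Id permutes_id s]
      by (simp add: z_el_def rmul_def val_def rtrancl_Id_inv_image)
  qed
qed

lemma evalw_eq:
  assumes "set w \<subseteq> gens n" "w \<noteq> []"
  shows "evalw n w = val n w"
proof -
  \<comment> \<open>The accumulator is the value of the prefix \<open>u\<close> read so far, which
    has to vary in the induction.\<close>
  have *: "foldl (rmul n) (val n u) (map (gen_val n) v) = val n (u @ v)"
    if "set u \<subseteq> gens n" "set v \<subseteq> gens n" for u v
    using that
  proof (induction v arbitrary: u)
    case (Cons g v)
    then show ?case
      using Cons.IH[of "u @ [g]"] val_append[of u n "[g]"] by (simp add: gen_val_eq)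
  qed simp
  show ?thesis using assms *[of "[hd w]" "tl w"] by (cases w) (auto simp: gen_val_eq)
qed

section \<open>Soundness of the relations\<close>

lemma in_gens_iff:
  "E i j \<in> gens n \<longleftrightarrow> pair_ok n i j"
  "Z r i j \<in> gens n \<longleftrightarrow> r_ok n r \<and> pair_ok n i j"
  "E' i j \<in> gens n \<longleftrightarrow> idx n i j"
  "Z' r i j \<in> gens n \<longleftrightarrow> r_ok n r \<and> idx n i j"
  by (auto simp: gens_def E'_def Z'_def)

lemma rels_gens:
  assumes "rels n u v"
  shows "set u \<subseteq> gens n \<and> set v \<subseteq> gens n"
proof -
  have st: "Suc 0 \<le> r \<Longrightarrow> Suc 0 \<le> i \<Longrightarrow> Suc 0 \<le> st r i"
    "Suc 0 \<le> r \<Longrightarrow> r \<le> n - Suc 0 \<Longrightarrow> i \<le> n \<Longrightarrow> st r i \<le> n" for r i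
    by (auto simp: st_def)
  show ?thesis using assms by cases (auto simp: in_gens_iff intro!: st)
qed

lemma Eqv_two_steps: "(x, y) \<in> S \<union> S\<inverse> \<Longrightarrow> (y, z) \<in> S \<union> S\<inverse> \<Longrightarrow> (x, z) \<in> Eqv S"
  unfolding Eqv_def by (meson r_into_rtrancl rtrancl_into_rtrancl)

lemma Eqv_triangle:
  "Eqv {(i, j), (i, k)} = Eqv {(i, j), (j, k)}"
  "Eqv {(i, j), (j, k)} = Eqv {(i, k), (j, k)}"
proof -
  have "(j, k) \<in> Eqv {(i, j), (i, k)}" by (rule Eqv_two_steps[of j i _ k]) auto
  moreover have "(i, k) \<in> Eqv {(i, j), (j, k)}" by (rule Eqv_two_steps[of i j _ k]) auto
  moreover have "(i, j) \<in> Eqv {(i, k), (j, k)}" by (rule Eqv_two_steps[of i k _ j]) auto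
  ultimately show "Eqv {(i, j), (i, k)} = Eqv {(i, j), (j, k)}"
    "Eqv {(i, j), (j, k)} = Eqv {(i, k), (j, k)}"
    using subset_Eqv[of "{(i, j), (i, k)}"] subset_Eqv[of "{(i, j), (j, k)}"]
      subset_Eqv[of "{(i, k), (j, k)}"]
    by (auto intro!: Eqv_eqI)
qed

text \<open>Symmetric closure forgets the order inside pairs, so sorting the indices of a letter has
  no effect.\<close>

definition sym_pairs :: "gen list \<Rightarrow> (nat \<times> nat) set" where
  "sym_pairs w = set (pair_list w) \<union> (set (pair_list w))\<inverse>"

lemma sym_pairs_simps:
  "sym_pairs [] = {}"
  "sym_pairs (E i j # w) = {(i, j), (j, i)} \<union> sym_pairs w"
  "sym_pairs (Z r i j # w) = {(i, j), (j, i)} \<union> map_prod (st r) (st r) ` sym_pairs w"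
  by (auto simp: sym_pairs_def image_iff)

lemma sym_pairs_simps':
  "sym_pairs (E' i j # w) = {(i, j), (j, i)} \<union> sym_pairs w"
  "sym_pairs (Z' r i j # w) = {(i, j), (j, i)} \<union> map_prod (st r) (st r) ` sym_pairs w"
  unfolding E'_def Z'_def sym_pairs_simps by (auto simp: min_def max_def)

lemma st_braid: "r = t + 1 \<or> t = r + 1 \<Longrightarrow> st r (st t (st r i)) = st t (st r (st t i))"
  by (auto simp: st_def)

lemma st_far: "r + 1 < t \<or> t + 1 < r \<Longrightarrow> st r (st t i) = st t (st r i)"
  by (auto simp: st_def)

text \<open>Apart from the three-index relations, both sides already agree in
  \<open>sym_pairs\<close>; only those two need the transitive closure.\<close>

lemma rels_val:
  assumes "rels n u v"
  shows "val n u = val n v"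
proof -
  have "perm_of (perm_word u) = perm_of (perm_word v)"
    using assms by cases (auto simp: E'_def Z'_def fun_eq_iff intro: st_braid st_far)
  moreover have "Eqv (set (pair_list u)) = Eqv (set (pair_list v))"
  proof -
    have sym: "Eqv (set (pair_list w)) = (sym_pairs w)\<^sup>*" for w
      by (simp add: Eqv_def sym_pairs_def)
    from assms show ?thesis
    proof cases
      case a3
      then show ?thesis using Eqv_triangle(1) by simp
    next
      case a4
      then show ?thesis using Eqv_triangle(2) by simp
    qed (simp_all only: sym, simp_all add: sym_pairs_simps sym_pairs_simps' insert_commute)
  qed
  ultimately show ?thesis by (simp add: val_def)
qed

text \<open>Membership in \<open>gens n\<close> is carried in both directions so that symmetry and
  transitivity go through: the intermediate words of a derivation then consist of generators as
  well.\<close>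

lemma wcong_sound:
  assumes "wcong n u v"
  shows "(set u \<subseteq> gens n \<longleftrightarrow> set v \<subseteq> gens n) \<and> (set u \<subseteq> gens n \<longrightarrow> val n u = val n v)"
  using assms
proof (induction rule: wcong.induct)
  case (step u v x y)
  note g = rels_gens[OF step]
  have "val n (x @ u @ y) = val n (x @ v @ y)" if "set x \<subseteq> gens n" "set y \<subseteq> gens n"
  proof -
    have "val n (x @ w @ y) = rmul n (val n x) (rmul n (val n w) (val n y))" if "set w \<subseteq> gens n" for w
      using that \<open>set x \<subseteq> gens n\<close> \<open>set y \<subseteq> gens n\<close> by (simp add: val_append)
    then show ?thesis using g rels_val[OF step] by simp
  qed
  then show ?case using g by auto
qed auto

text \<open>The first component determines the permutation; with it known, the second determines the
  equivalence relation.\<close>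

lemma val_eq_imp_wcong:
  assumes w: "set w \<subseteq> gens n" "w \<noteq> []" and w': "set w' \<subseteq> gens n" "w' \<noteq> []"
    and eq: "val n w = val n w'"
  shows "wcong n w w'"
proof -
  note f = perm_word_permutes[OF w(1)] and f' = perm_word_permutes[OF w'(1)]
  have perm: "perm_of (perm_word w) = perm_of (perm_word w')"
    using eq by (intro part_Id_inject[OF f f']) (simp add: val_def)
  have "Eqv (set (pair_list w)) = Eqv (set (pair_list w'))"
    using eq perm
    by (intro part_inject[OF eqv_on_pair_list[OF w(1)] eqv_on_pair_list[OF w'(1)] f]) (simp add: val_def)
  then show ?thesis by (rule wcong_complete[OF w w' _ perm])
qed

section \<open>The image of the evaluation map\<close>

lemma part_Id_Sym: "f permutes {1..n} \<Longrightarrow> part n Id f \<in> Sym n"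
proof -
  assume f: "f permutes {1..n}"
  have "\<exists>i j. 1 \<le> i \<and> i \<le> n \<and> 1 \<le> j \<and> j \<le> n \<and> B = {i, n + j}" if "B \<in> part n Id f" for B
  proof -
    from that obtain i where i: "i \<in> {1..n}" "B = Id `` {i} \<union> (\<lambda>k. n + f k) ` (Id `` {i})"
      unfolding part_blocks[OF eqv_on_Id f] by blast
    then have "B = {i, n + f i}" by auto
    then show ?thesis using i(1) permutes_in_image[OF f, of i] by auto
  qed
  then show ?thesis using setpart_part[OF eqv_on_Id] by (auto simp: Sym_def)
qed

text \<open>The first letter contributes a pair of distinct points, so the equivalence relation is
  not equality and the two components differ.\<close>

lemma val_in_sRS:
  assumes w: "set w \<subseteq> gens n" "w \<noteq> []"
  shows "val n w \<in> sRS n"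
proof -
  let ?f = "perm_of (perm_word w)" and ?K = "Eqv (set (pair_list w))"
  note f = perm_word_permutes[OF w(1)] and K = eqv_on_pair_list[OF w(1)]
  have "refines (part n Id ?f) (part n ?K ?f)"
    unfolding refines_def
  proof
    fix B assume "B \<in> part n ?K ?f"
    then obtain i where i: "i \<in> {1..n}" "B = ?K `` {i} \<union> (\<lambda>k. n + ?f k) ` (?K `` {i})"
      unfolding part_blocks[OF K f] by auto
    then have "(\<lambda>k. {k, n + ?f k}) ` (?K `` {i}) \<subseteq> part n Id ?f"
      unfolding part_blocks[OF eqv_on_Id f] using eqv_on_range[OF K] by fastforce
    moreover have "B = \<Union> ((\<lambda>k. {k, n + ?f k}) ` (?K `` {i}))" using i by auto
    ultimately show "\<exists>C \<subseteq> part n Id ?f. B = \<Union> C" by blast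
  qed
  moreover have "part n Id ?f \<noteq> part n ?K ?f"
  proof
    assume "part n Id ?f = part n ?K ?f"
    then have "Id = ?K" by (rule part_inject[OF eqv_on_Id K f])
    moreover obtain i j where ij: "(i, j) \<in> set (pair_list w)"
    proof -
      obtain g v where "w = g # v" using w(2) by (cases w) auto
      then show ?thesis using that by (cases g) auto
    qed
    ultimately have "i = j" using subset_Eqv[of "set (pair_list w)"] by auto
    moreover have "idx n i j" using ij pair_list_idxs[OF w(1)] by auto
    ultimately show False by simp
  qed
  ultimately show ?thesis
    using part_Id_Sym[OF f] setpart_part[OF K] by (auto simp: sRS_def RS_def val_def)
qed

lemma Sym_eq_part:
  assumes "I \<in> Sym n"
  obtains f where "f permutes {1..n}" "I = part n Id f"
proof -
  have I: "partition_on {1..2*n} I \<and>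
      (\<forall>B\<in>I. \<exists>i j. 1 \<le> i \<and> i \<le> n \<and> 1 \<le> j \<and> j \<le> n \<and> B = {i, n + j})"
    using assms unfolding Sym_def setpart_def mem_Collect_eq .
  note P = conjunct1[OF I] and blk = bspec[OF conjunct2[OF I]]
  have uniq: "B = C" if "B \<in> I" "C \<in> I" "x \<in> B" "x \<in> C" for B C x
    using partition_onD2[OF P] that unfolding disjoint_def by blast
  have ex: "\<exists>j. j \<in> {1..n} \<and> {i, n + j} \<in> I" if i: "i \<in> {1..n}" for i
  proof -
    have "i \<in> \<Union> I" using P i by (auto simp: partition_on_def)
    then obtain B where B: "B \<in> I" "i \<in> B" by blast
    obtain a b where ab: "1 \<le> a" "a \<le> n" "1 \<le> b" "b \<le> n" "B = {a, n + b}" using blk[OF B(1)] by blast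
    then have "i = a" using B(2) i by auto
    then show ?thesis using B(1) ab by (intro exI[of _ b]) auto
  qed
  \<comment> \<open>The value \<open>i\<close> outside \<open>{1..n}\<close> is what
    \<open>permutes\<close> demands.\<close>
  define f where "f i = (if i \<in> {1..n} then SOME j. j \<in> {1..n} \<and> {i, n + j} \<in> I else i)" for i
  have f: "f i \<in> {1..n}" "{i, n + f i} \<in> I" if "i \<in> {1..n}" for i
    using someI_ex[OF ex[OF that]] that by (auto simp: f_def)
  have inj: "inj_on f {1..n}"
  proof (rule inj_onI)
    fix i k assume ik: "i \<in> {1..n}" "k \<in> {1..n}" "f i = f k"
    have "{i, n + f i} = {k, n + f k}"
      by (rule uniq[OF f(2) f(2), of _ _ "n + f i"]) (use ik in auto)
    then show "i = k" using ik by (auto simp: doubleton_eq_iff)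
  qed
  have perm: "f permutes {1..n}"
  proof (rule bij_imp_permutes)
    have "f ` {1..n} \<subseteq> {1..n}" using f by blast
    then have "f ` {1..n} = {1..n}" by (intro endo_inj_surj inj) auto
    then show "bij_betw f {1..n} {1..n}" using inj by (simp add: bij_betw_def)
  qed (auto simp: f_def)
  have "I = (\<lambda>i. {i, n + f i}) ` {1..n}"
  proof
    show "(\<lambda>i. {i, n + f i}) ` {1..n} \<subseteq> I" using f by auto
    show "I \<subseteq> (\<lambda>i. {i, n + f i}) ` {1..n}"
    proof
      fix B assume B: "B \<in> I"
      obtain i j where "1 \<le> i" "i \<le> n" "B = {i, n + j}" using blk[OF B] by blast
      then have i: "i \<in> {1..n}" "B = {i, n + j}" by auto
      then have "B = {i, n + f i}" using uniq[OF B f(2)[OF i(1)], of i] by auto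
      then show "B \<in> (\<lambda>i. {i, n + f i}) ` {1..n}" using i by auto
    qed
  qed
  also have "\<dots> = part n Id f" unfolding part_blocks[OF eqv_on_Id perm] by auto
  finally show ?thesis by (rule that[OF perm])
qed

text \<open>Blocks of \<open>J\<close> are unions of blocks of the permutation, so each point shares
  its block with its top partner, and \<open>J\<close> is determined by its restriction to the top
  points.\<close>

lemma refines_eq_part:
  assumes f: "f permutes {1..n}" and J: "setpart n J" and ref: "refines (part n Id f) J"
  obtains K where "eqv_on n K" "J = part n K f"
proof -
  have P: "partition_on {1..2*n} J" using J by (simp add: setpart_def)
  define S where "S = {(x, y). \<exists>B \<in> J. x \<in> B \<and> y \<in> B}"
  have eqS: "equiv {1..2*n} S" unfolding S_def by (rule equiv_partition_on[OF P])
  \<comment> \<open>Adding \<open>Id\<close> extends the restricted relation to an equivalence on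
    all natural numbers.\<close>
  define K where "K = Id \<union> (S \<inter> {1..n} \<times> {1..n})"
  have Ssym: "\<And>x y. (x, y) \<in> S \<Longrightarrow> (y, x) \<in> S" and Str: "\<And>x y z. (x, y) \<in> S \<Longrightarrow> (y, z) \<in> S \<Longrightarrow> (x, z) \<in> S"
    using eqS by (auto simp: equiv_def dest: symD transD)
  have K: "eqv_on n K"
    unfolding eqv_on_def K_def
    by (intro conjI equivI refl_onI symI transI) (auto intro: Ssym Str)
  have top: "(x, top_of n f x) \<in> S" if x: "x \<in> {1..2*n}" for x
  proof -
    have "x \<in> \<Union> J" using P x by (auto simp: partition_on_def)
    then obtain B where B: "B \<in> J" "x \<in> B" by blast
    then obtain C where C: "C \<subseteq> part n Id f" "B = \<Union> C" using ref by (auto simp: refines_def)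
    then obtain D where D: "D \<in> C" "x \<in> D" using B by blast
    have "(x, top_of n f x) \<in> prel n Id f"
      using x top_of_range[OF f x] by (auto simp: prel_def top_of_top)
    then have "top_of n f x \<in> D"
      using in_quotient_imp_closed[OF equiv_prel[OF eqv_on_Id], of D n f x] C(1) D
      unfolding part_def by blast
    then show ?thesis using B C D by (auto simp: S_def)
  qed
  have "S = prel n K f"
  proof (intro set_eqI, clarify)
    fix x y
    show "(x, y) \<in> S \<longleftrightarrow> (x, y) \<in> prel n K f"
    proof
      assume xy: "(x, y) \<in> S"
      then have xy': "x \<in> {1..2*n}" "y \<in> {1..2*n}" using eqS by (auto simp: equiv_def)
      have "(top_of n f x, top_of n f y) \<in> S"
        using Str[OF Ssym[OF top[OF xy'(1)]] Str[OF xy top[OF xy'(2)]]] .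
      then show "(x, y) \<in> prel n K f"
        using xy' top_of_range[OF f] by (simp add: prel_def K_def)
    next
      assume "(x, y) \<in> prel n K f"
      then have xy: "x \<in> {1..2*n}" "y \<in> {1..2*n}" "(top_of n f x, top_of n f y) \<in> K"
        by (auto simp: prel_def)
      then show "(x, y) \<in> S"
        using top[OF xy(1)] top[OF xy(2)] Ssym Str unfolding K_def
        by (metis IntE UnE pair_in_Id_conv)
    qed
  qed
  then have "J = part n K f"
    using partition_on_eq_quotient[OF P] unfolding part_def S_def by simp
  then show ?thesis using that K by blast
qed

lemma exists_perm_word:
  assumes "f permutes {1..n}"
  shows "\<exists>rs. set rs \<subseteq> {1..n - 1} \<and> perm_of rs = f"
proof (cases n)
  case 0
  then show ?thesis using assms by (intro exI[of _ "[]"]) (auto simp: permutes_def fun_eq_iff)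
next
  case (Suc m)
  then show ?thesis using permutes_perm_of[of f m] assms by simp
qed

lemma Zseq_gens: "set rs \<subseteq> {1..n - 1} \<Longrightarrow> idx n i j \<Longrightarrow> set (Zseq i j rs) \<subseteq> gens n"
proof (induction rs arbitrary: i j)
  case (Cons r rs)
  then have r: "r_ok n r" "set rs \<subseteq> {1..n - 1}" by auto
  then show ?case
    using Cons.IH[OF r(2) idx_st[OF r(1) Cons.prems(2)]] Cons.prems(2) in_gens_iff(4) by auto
qed simp

lemma perm_word_Zseq: "perm_word (Zseq i j rs) = rs"
  by (induction rs arbitrary: i j) (auto simp: Z'_def)

text \<open>Moving the index pair of any later letter to the front returns the starting pair, so a
  lift adds at most this one identification.\<close>

lemma pair_list_Zseq: "set (pair_list (Zseq i j rs)) \<subseteq> {(i, j), (j, i)}"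
proof (induction rs arbitrary: i j)
  case (Cons r rs)
  have "map_prod (st r) (st r) ` set (pair_list (Zseq (st r i) (st r j) rs)) \<subseteq> {(i, j), (j, i)}"
    using Cons.IH[of "st r i" "st r j"] by fastforce
  then show ?case by (auto simp: Z'_def min_def max_def)
qed simp

lemma perm_word_Ew: "perm_word (Ew L) = []"
  by (induction L) (auto simp: E'_def)

lemma pair_list_Ew: "\<forall>(i, j) \<in> set L. i < j \<Longrightarrow> pair_list (Ew L) = L"
  by (induction L) (auto simp: E'_def)

text \<open>The word lists the idempotents of all pairs \<open>a < b\<close> in the equivalence
  relation and then lifts the permutation along one of them. Such a pair exists because the two
  components differ.\<close>

lemma sRS_generated:
  assumes "x \<in> sRS n"
  shows "\<exists>w. w \<noteq> [] \<and> set w \<subseteq> gens n \<and> val n w = x"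
proof -
  obtain I J where x: "x = (I, J)" by force
  have I: "I \<in> Sym n" and J: "setpart n J" "refines I J" and ne: "I \<noteq> J"
    using assms by (auto simp: x sRS_def RS_def)
  obtain f where f: "f permutes {1..n}" "I = part n Id f" using Sym_eq_part[OF I] .
  obtain K where K: "eqv_on n K" "J = part n K f"
    using refines_eq_part[OF f(1) J(1)] J(2) f(2) by blast
  have "K \<noteq> Id" using ne f K by auto
  have Esub: "(a, b) \<in> K \<Longrightarrow> a = b \<or> a \<in> {1..n} \<and> b \<in> {1..n}" for a b
    using K(1) by (auto simp: eqv_on_def)
  define T where "T = {(a, b) \<in> K. a < b}"
  have "T \<subseteq> {1..n} \<times> {1..n}" using Esub by (fastforce simp: T_def)
  then have "finite T" by (rule finite_subset) auto
  then obtain L where L: "set L = T" using finite_list by blast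
  obtain a b where "(a, b) \<in> K" "a \<noteq> b" using \<open>K \<noteq> Id\<close> eqv_on_refl[OF K(1)] by auto
  then have "(min a b, max a b) \<in> T"
    using eqv_on_sym[OF K(1)] by (auto simp: T_def min_def max_def)
  then obtain i j where ij: "(i, j) \<in> T" by blast
  have TE: "T \<subseteq> K" by (auto simp: T_def)
  have idxT: "idx n a b" if "(a, b) \<in> T" for a b using Esub[of a b] that by (auto simp: T_def)
  obtain rs where rs: "set rs \<subseteq> {1..n - 1}" "perm_of rs = f"
    using exists_perm_word[OF f(1)] by blast
  define w where "w = Ew L @ Zseq i j rs"
  have gw: "set w \<subseteq> gens n"
    using Zseq_gens[OF rs(1) idxT[OF ij]] idxT L in_gens_iff(3) unfolding w_def by auto
  have "w \<noteq> []" using ij L by (auto simp: w_def)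
  have perm: "perm_of (perm_word w) = f"
    by (simp add: w_def perm_word_append perm_word_Ew perm_word_Zseq rs)
  have "set (pair_list (Ew L)) = T" using pair_list_Ew[of L] L by (auto simp: T_def)
  then have pl: "set (pair_list w) = T \<union> set (pair_list (Zseq i j rs))"
    by (auto simp: w_def set_pair_list_append perm_word_Ew)
  have "Eqv (set (pair_list w)) = K"
  proof
    have sub: "set (pair_list w) \<subseteq> K"
      using pl subset_trans[OF pair_list_Zseq, of i j K rs] ij TE eqv_on_sym[OF K(1), of i j] by auto
    have "(a, b) \<in> K" if "(a, b) \<in> Eqv (set (pair_list w))" for a b
      using that unfolding Eqv_def
    proof (induction rule: rtrancl_induct)
      case base
      show ?case by (rule eqv_on_refl[OF K(1)])
    next
      case (step b c)
      then have "(b, c) \<in> K" using sub eqv_on_sym[OF K(1), of c b] by auto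
      with step.IH show ?case by (rule eqv_on_trans[OF K(1)])
    qed
    then show "Eqv (set (pair_list w)) \<subseteq> K" by auto
    show "K \<subseteq> Eqv (set (pair_list w))"
    proof clarify
      fix a b assume ab: "(a, b) \<in> K"
      consider "a = b" | "(a, b) \<in> T" | "(b, a) \<in> T"
        using ab eqv_on_sym[OF K(1) ab] by (auto simp: T_def) linarith
      then show "(a, b) \<in> Eqv (set (pair_list w))"
        unfolding Eqv_def pl by cases (auto intro: r_into_rtrancl)
    qed
  qed
  then have "val n w = x" using perm by (simp add: val_def x f K)
  then show ?thesis using gw \<open>w \<noteq> []\<close> by blast
qed

theorem theorem5p20:
  shows "(\<forall>w. w \<noteq> [] \<and> set w \<subseteq> gens n \<longrightarrow> evalw n w \<in> sRS n)
       \<and> (\<forall>x \<in> sRS n. \<exists>w. w \<noteq> [] \<and> set w \<subseteq> gens n \<and> evalw n w = x)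
       \<and> (\<forall>w w'. w \<noteq> [] \<longrightarrow> set w \<subseteq> gens n \<longrightarrow> w' \<noteq> [] \<longrightarrow> set w' \<subseteq> gens n \<longrightarrow>
              (evalw n w = evalw n w' \<longleftrightarrow> wcong n w w'))"
proof (intro conjI allI impI ballI)
  fix w assume "w \<noteq> [] \<and> set w \<subseteq> gens n"
  then show "evalw n w \<in> sRS n" by (simp add: evalw_eq val_in_sRS)
next
  fix x assume "x \<in> sRS n"
  then show "\<exists>w. w \<noteq> [] \<and> set w \<subseteq> gens n \<and> evalw n w = x"
    using sRS_generated evalw_eq by metis
next
  fix w w' assume w: "w \<noteq> []" "set w \<subseteq> gens n" "w' \<noteq> []" "set w' \<subseteq> gens n"
  then show "evalw n w = evalw n w' \<longleftrightarrow> wcong n w w'"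
    using wcong_sound[of n w w'] val_eq_imp_wcong[of w n w'] by (auto simp: evalw_eq)
qed

end
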